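(* Let $T$ be a countable set, $\alpha>0$, and let $\{X_t,t\in T\}$ be an associated $\alpha$-permanental process with kernel $\{u(s,t),s,t\in T\}$. For distinct $t_1,\dots,t_n\in T$ let $a_1^*(t_1,\dots,t_n)\le\dots\le a_n^*(t_1,\dots,t_n)$ be the non-decreasing rearrangement of the diagonal elements of $\left(\{u(t_i,t_j)\}_{i,j=1}^n\right)^{-1}$. Let $p\ge1$ be an integer and, for $n\ge p$, let $$\psi^*_{[n/p]}=\inf_{(t_1,\dots,t_n)} a^*_{[n/p]}(t_1,\dots,t_n),$$ the infimum being over all $n$-tuples of distinct elements of $T$, where $[\cdot]$ denotes integer part. If $$\limsup_{n\to\infty}\frac{\log n}{\psi^*_{[n/p]}}=\infty,$$ then $\sup_{t\in T}X_t=\infty$ almost surely.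
   Context: For $\alpha>0$, an $\alpha$-permanental process with kernel $\{u(s,t),s,t\in T\}$ is a non-negative stochastic process $\{X_t,t\in T\}$ such that for all $t_1,\dots,t_n\in T$ and $s_1,\dots,s_n\ge 0$, $E\left(e^{-\sum_i s_iX_{t_i}}\right)=|I+KS|^{-\alpha}$ with $K=\{u(t_i,t_j)\}_{i,j=1}^n$, $S=\mathrm{diag}(s_1,\dots,s_n)$ and $|\cdot|$ the determinant. It is called an associated $\alpha$-permanental process if $u$ is the potential density of a transient Markov process with state space $T$; the process is taken to have local times $L^y_t$ normalized so that $u(x,y)=E^x(L^y_\infty)<\infty$. It is a known fact that for such $u$ an $\alpha$-permanental process with kernel $u$ exists for every $\alpha>0$, and that for distinct $t_1,\dots,t_n\in T$ the matrix $\{u(t_i,t_j)\}_{i,j=1}^n$ is invertible and its inverse is a nonsingular $M$-matrix (off-diagonal entries $\le 0$, inverse entrywise $\ge 0$). Conventions: $\inf\emptyset=+\infty$, $c/\infty=0$ and $c/0=\infty$ for $c>0$. *)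

theory Defs
  imports
    "HOL-Probability.Probability"
    "Jordan_Normal_Form.Gauss_Jordan_Elimination"
    "Jordan_Normal_Form.Determinant"
begin

section \<open>Permanental processes\<close>

definition kernel_mat :: "('a \<Rightarrow> 'a \<Rightarrow> real) \<Rightarrow> 'a list \<Rightarrow> real mat" where
  "kernel_mat u ts = Matrix.mat (length ts) (length ts) (\<lambda>(i, j). u (ts ! i) (ts ! j))"

text \<open>An \<open>n\<close>-tuple is a list of length \<open>n\<close>; its entries may repeat here.  Both the expectation and
  the determinant are continuous in \<open>s\<close> and equal 1 at \<open>s = 0\<close>, so the equation forces the
  determinant to stay positive, and \<open>powr\<close> (with \<open>0 powr _ = 0\<close>) is only ever evaluated at a
  positive base.\<close>

definition permanental_process ::
    "'s measure \<Rightarrow> 'a set \<Rightarrow> real \<Rightarrow> ('a \<Rightarrow> 'a \<Rightarrow> real) \<Rightarrow> ('a \<Rightarrow> 's \<Rightarrow> real) \<Rightarrow> bool" where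
  "permanental_process M T \<alpha> u X \<longleftrightarrow>
     prob_space M \<and>
     (\<forall>t\<in>T. X t \<in> borel_measurable M \<and> (\<forall>\<omega>\<in>space M. 0 \<le> X t \<omega>)) \<and>
     (\<forall>n ts s. length ts = n \<longrightarrow> set ts \<subseteq> T \<longrightarrow> (\<forall>i<n. 0 \<le> s i) \<longrightarrow>
        (\<integral>\<omega>. exp (- (\<Sum>i<n. s i * X (ts ! i) \<omega>)) \<partial>M)
          = Determinant.det (1\<^sub>m n + kernel_mat u ts * mat_diag n s) powr (- \<alpha>))"

section \<open>Transient Markov processes with local times\<close>

text \<open>A strong Markov process with state space \<open>T\<close>, in the sense of Blumenthal and Getoor.  The
  cemetery is \<open>None\<close>.  Time ranges over \<open>[0, \<infinity>]\<close>, so that stopping times are \<open>ennreal\<close>-valued, and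
  \<open>Y \<infinity> = None\<close>.  The set \<open>T\<close> is meant to be countable and carries its power set as \<open>\<sigma>\<close>-algebra; no
  topology on \<open>T\<close> is fixed, and of the path regularity of a right process only its measurability
  consequences (joint measurability, measurability at stopping times) are kept.
  The \<open>\<sigma>\<close>-algebra \<open>A\<close> may be a completion of the one generated by the process.\<close>

locale strong_markov_process = filtration \<Omega> F
  for \<Omega> :: "'w set" and F :: "ennreal \<Rightarrow> 'w measure" +
  fixes A :: "'w measure"
    and T :: "'a set"
    and P :: "'a option \<Rightarrow> 'w measure"
    and Y :: "ennreal \<Rightarrow> 'w \<Rightarrow> 'a option"
    and \<theta> :: "ennreal \<Rightarrow> 'w \<Rightarrow> 'w"
  assumes space_A: "space A = \<Omega>"
    and sets_F_subset: "\<And>t. sets (F t) \<subseteq> sets A"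
    and F_right_continuous: "\<And>t. t < \<infinity> \<Longrightarrow> sets (F t) = (\<Inter>s\<in>{t<..}. sets (F s))"
    and F_augmented: "\<And>N B t. N \<in> sets A \<Longrightarrow> (\<And>x. x \<in> insert None (Some ` T) \<Longrightarrow> emeasure (P x) N = 0) \<Longrightarrow>
        B \<subseteq> N \<Longrightarrow> B \<in> sets (F t)"
    and P_prob: "\<And>x. x \<in> insert None (Some ` T) \<Longrightarrow> prob_space (P x) \<and> sets (P x) = sets A"
    and Y_adapted: "\<And>t. Y t \<in> F t \<rightarrow>\<^sub>M count_space (insert None (Some ` T))"
    and Y_jointly_measurable:
        "(\<lambda>(t, \<omega>). Y t \<omega>) \<in> borel \<Otimes>\<^sub>M A \<rightarrow>\<^sub>M count_space (insert None (Some ` T))"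
    and Y_start: "\<And>x. x \<in> insert None (Some ` T) \<Longrightarrow> AE \<omega> in P x. Y 0 \<omega> = x"
    and Y_absorbed: "\<And>s t \<omega>. \<omega> \<in> \<Omega> \<Longrightarrow> t \<le> s \<Longrightarrow> Y t \<omega> = None \<Longrightarrow> Y s \<omega> = None"
    and Y_infinity: "\<And>\<omega>. \<omega> \<in> \<Omega> \<Longrightarrow> Y \<infinity> \<omega> = None"
    and shift_space: "\<And>t \<omega>. \<omega> \<in> \<Omega> \<Longrightarrow> \<theta> t \<omega> \<in> \<Omega>"
    and Y_shift: "\<And>s t \<omega>. \<omega> \<in> \<Omega> \<Longrightarrow> s < \<infinity> \<Longrightarrow> t < \<infinity> \<Longrightarrow> Y s (\<theta> t \<omega>) = Y (t + s) \<omega>"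
    and Y_at_stopping_time: "\<And>\<tau>. stopping_time F \<tau> \<Longrightarrow>
        (\<lambda>\<omega>. Y (\<tau> \<omega>) \<omega>) \<in> pre_sigma \<tau> \<rightarrow>\<^sub>M count_space (insert None (Some ` T))"
    and shift_at_stopping_time: "\<And>\<tau> \<Lambda>. stopping_time F \<tau> \<Longrightarrow> \<Lambda> \<in> sets A \<Longrightarrow>
        {\<omega>\<in>\<Omega>. \<tau> \<omega> < \<infinity> \<and> \<theta> (\<tau> \<omega>) \<omega> \<in> \<Lambda>} \<in> sets A"
    and strong_markov: "\<And>\<tau> G \<Lambda> x. stopping_time F \<tau> \<Longrightarrow> G \<in> sets (pre_sigma \<tau>) \<Longrightarrow> \<Lambda> \<in> sets A \<Longrightarrow>
        x \<in> insert None (Some ` T) \<Longrightarrow>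
        emeasure (P x) {\<omega>\<in>G. \<tau> \<omega> < \<infinity> \<and> \<theta> (\<tau> \<omega>) \<omega> \<in> \<Lambda>}
          = (\<integral>\<^sup>+\<omega>\<in>{\<omega>\<in>G. \<tau> \<omega> < \<infinity>}. emeasure (P (Y (\<tau> \<omega>) \<omega>)) \<Lambda> \<partial>P x)"
begin

text \<open>Continuity is required on all of \<open>[0, \<infinity>]\<close>, i.e. \<open>C \<infinity>\<close> is the limit of \<open>C t\<close> as \<open>t \<rightarrow> \<infinity>\<close>.\<close>

definition continuous_additive_functional :: "(ennreal \<Rightarrow> 'w \<Rightarrow> ennreal) \<Rightarrow> bool" where
  "continuous_additive_functional C \<longleftrightarrow>
     (\<forall>t. C t \<in> borel_measurable (F t)) \<and>
     (\<forall>x\<in>insert None (Some ` T). AE \<omega> in P x.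
        C 0 \<omega> = 0 \<and> mono (\<lambda>t. C t \<omega>) \<and> continuous_on UNIV (\<lambda>t. C t \<omega>) \<and>
        (\<forall>t<\<infinity>. C t \<omega> < \<infinity>) \<and>
        (\<forall>s t. t \<le> s \<longrightarrow> Y t \<omega> = None \<longrightarrow> C s \<omega> = C t \<omega>) \<and>
        (\<forall>s t. s < \<infinity> \<longrightarrow> t < \<infinity> \<longrightarrow> C (t + s) \<omega> = C t \<omega> + C s (\<theta> t \<omega>)))"

text \<open>With \<open>R = inf {t. C t > 0}\<close>: \<open>C\<close> is a local time at \<open>y\<close> if \<open>R = 0\<close> almost surely under \<open>P\<^sup>y\<close>
  and \<open>R > 0\<close> almost surely under \<open>P\<^sup>x\<close> for every other state \<open>x\<close>.\<close>

definition local_time_at :: "'a \<Rightarrow> (ennreal \<Rightarrow> 'w \<Rightarrow> ennreal) \<Rightarrow> bool" where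
  "local_time_at y C \<longleftrightarrow>
     continuous_additive_functional C \<and>
     (AE \<omega> in P (Some y). Inf {t. 0 < C t \<omega>} = 0) \<and>
     (\<forall>x\<in>T - {y}. AE \<omega> in P (Some x). 0 < Inf {t. 0 < C t \<omega>})"

end

text \<open>The kernel \<open>u\<close> is the potential density of the process with respect to a \<open>\<sigma>\<close>-finite measure
  \<open>m\<close>, and the local times \<open>L y\<close> are normalized by \<open>u x y = E\<^sup>x (L y \<infinity>)\<close>.  Transience is expressed
  by the finiteness of \<open>u\<close>, which is real-valued.  Since \<open>m {y} = 0\<close> is possible, the
  potential density equation alone need not determine \<open>u\<close>; the local times do.\<close>

locale transient_markov_process_with_local_times = strong_markov_process \<Omega> F A T P Y \<theta>
  for \<Omega> :: "'w set" and F :: "ennreal \<Rightarrow> 'w measure" and A :: "'w measure" and T :: "'a set"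
    and P :: "'a option \<Rightarrow> 'w measure" and Y :: "ennreal \<Rightarrow> 'w \<Rightarrow> 'a option"
    and \<theta> :: "ennreal \<Rightarrow> 'w \<Rightarrow> 'w" +
  fixes m :: "'a measure"
    and L :: "'a \<Rightarrow> ennreal \<Rightarrow> 'w \<Rightarrow> ennreal"
    and u :: "'a \<Rightarrow> 'a \<Rightarrow> real"
  assumes m_sigma_finite: "sigma_finite_measure m"
    and sets_m: "sets m = Pow T"
    and u_nonneg: "\<And>x y. x \<in> T \<Longrightarrow> y \<in> T \<Longrightarrow> 0 \<le> u x y"
    and potential_density: "\<And>x B. x \<in> T \<Longrightarrow> B \<subseteq> T \<Longrightarrow>
        (\<integral>\<^sup>+t\<in>{0..}. emeasure (P (Some x)) {\<omega>\<in>\<Omega>. Y (ennreal t) \<omega> \<in> Some ` B} \<partial>lborel)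
          = (\<integral>\<^sup>+y\<in>B. ennreal (u x y) \<partial>m)"
    and local_time: "\<And>y. y \<in> T \<Longrightarrow> local_time_at y (L y)"
    and local_time_normalized: "\<And>x y. x \<in> T \<Longrightarrow> y \<in> T \<Longrightarrow>
        ennreal (u x y) = (\<integral>\<^sup>+\<omega>. L y \<infinity> \<omega> \<partial>P (Some x))"

section \<open>The rearranged diagonal of the inverse kernel matrix\<close>

text \<open>\<open>a_star u ts k\<close> is the \<open>k\<close>-th smallest diagonal element, for \<open>1 \<le> k \<le> n\<close>.  It is
  only meaningful when the kernel matrix of \<open>ts\<close> is invertible, which is the case if \<open>u\<close> is a
  potential density as above and the entries of \<open>ts\<close> are distinct elements of the state space.\<close>

definition a_star :: "('a \<Rightarrow> 'a \<Rightarrow> real) \<Rightarrow> 'a list \<Rightarrow> nat \<Rightarrow> real" where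
  "a_star u ts k = sort (diag_mat (the (mat_inverse (kernel_mat u ts)))) ! (k - 1)"

definition psi_star :: "'a set \<Rightarrow> ('a \<Rightarrow> 'a \<Rightarrow> real) \<Rightarrow> nat \<Rightarrow> nat \<Rightarrow> ereal" where
  "psi_star T u n k =
     (INF ts\<in>{ts. length ts = n \<and> distinct ts \<and> set ts \<subseteq> T}. ereal (a_star u ts k))"

end

theory Submission
  imports Defs "HOL-Real_Asymp.Real_Asymp"
begin

text \<open>Let \<open>K\<close> be the kernel matrix of \<open>n\<close> distinct points.  The strong Markov property at the first
  entrance time into the other points shows that \<open>inverse K = D - B\<close> with \<open>D\<close> a positive diagonal
  matrix, \<open>B \<ge> 0\<close> and nonnegative row sums.  Hence the Laplace transform
  \<open>det (I + K S) powr (- \<alpha>) = (det (D - B) / det (D - B + S)) powr \<alpha>\<close> expands into a series with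
  nonnegative coefficients in products of the functions \<open>(a i + s i) powr (- \<alpha> - k i)\<close>, where \<open>a i\<close>
  are the diagonal entries of \<open>inverse K\<close>: the permanental vector is a mixture of vectors of
  independent gamma variables with shapes at least \<open>\<alpha>\<close> and rates \<open>a i\<close>.  So its maximum dominates
  the maximum of independent gamma variables with shape \<open>\<alpha>\<close> and rates \<open>a i\<close>.  If \<open>n div p\<close> of the
  rates are at most \<open>b\<close>, that maximum exceeds a constant multiple of \<open>ln n / b\<close> with high
  probability.\<close>

section \<open>Entrance times of additive functionals\<close>

text \<open>Independent gamma variables never occur as random variables in the formal argument, and
  neither does the mixture. Only the values of the Laplace transform at the points
  \<open>s i = r * J i\<close> with natural numbers \<open>J i\<close> enter: a product of
  polynomials in \<open>exp (- r * X t)\<close> stands in for the indicator of the event that all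
  coordinates are at most \<open>x\<close>, and the domination of maxima becomes an inequality
  between finite signed sums, proved by induction over the cone of admissible expansions. The event
  that \<open>X t \<le> x\<close> for all \<open>t\<close> does not depend on \<open>n\<close>.
  Hence single, arbitrarily large values of \<open>n\<close> suffice, and these are what a limit
  superior provides. For such \<open>n\<close> each of about \<open>n / p\<close> coordinates
  contributes at least a multiple of \<open>1 / sqrt n\<close> to the exponent, which therefore
  grows like \<open>sqrt n\<close>. Additive functionals are controlled almost surely under the
  starting laws, not on shifted paths. This is why the local time collected after an entrance time
  is written as a supremum over integer times.\<close>

definition rational_times :: "ennreal set" where
  "rational_times = ennreal ` \<rat>"

lemma countable_rational_times: "countable rational_times"
  unfolding rational_times_def using countable_rat by (rule countable_image)

lemma rational_times_finite: "d \<in> rational_times \<Longrightarrow> d < \<infinity>"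
  unfolding rational_times_def by auto

lemma rational_times_dense:
  assumes "x < y" shows "\<exists>d\<in>rational_times. x < d \<and> d < y"
proof -
  obtain r :: rat where "x < real_of_rat r" "real_of_rat r < y"
    using ennreal_rat_dense[OF assms] by blast
  then show ?thesis
    unfolding rational_times_def by (intro bexI[of _ "ennreal (real_of_rat r)"]) auto
qed

context strong_markov_process
begin

definition states :: "'a option set" where
  "states = insert None (Some ` T)"

text \<open>Rational times turn \<open>entry_time C \<omega> < t\<close> into a countable union of
  events. On a regular path, monotonicity and continuity make the value equal to the infimum over
  all times.\<close>

definition entry_time :: "(ennreal \<Rightarrow> 'w \<Rightarrow> ennreal) \<Rightarrow> 'w \<Rightarrow> ennreal" where
  "entry_time C \<omega> = Inf {t\<in>rational_times. 0 < C t \<omega>}"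

definition regular_path :: "(ennreal \<Rightarrow> 'w \<Rightarrow> ennreal) \<Rightarrow> 'w \<Rightarrow> bool" where
  "regular_path C \<omega> \<longleftrightarrow>
     C 0 \<omega> = 0 \<and> mono (\<lambda>t. C t \<omega>) \<and> continuous_on UNIV (\<lambda>t. C t \<omega>) \<and>
     (\<forall>t<\<infinity>. C t \<omega> < \<infinity>) \<and>
     (\<forall>s t. t \<le> s \<longrightarrow> Y t \<omega> = None \<longrightarrow> C s \<omega> = C t \<omega>) \<and>
     (\<forall>s t. s < \<infinity> \<longrightarrow> t < \<infinity> \<longrightarrow> C (t + s) \<omega> = C t \<omega> + C s (\<theta> t \<omega>))"

lemma continuous_additive_functional_alt:
  "continuous_additive_functional C \<longleftrightarrow>
     (\<forall>t. C t \<in> borel_measurable (F t)) \<and> (\<forall>x\<in>states. AE \<omega> in P x. regular_path C \<omega>)"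
  unfolding continuous_additive_functional_def regular_path_def states_def ..

lemma continuous_additive_functional_zero: "continuous_additive_functional (\<lambda>_ _. 0)"
  unfolding continuous_additive_functional_alt regular_path_def by (auto simp: mono_def)

lemma continuous_additive_functional_add:
  assumes "continuous_additive_functional C" "continuous_additive_functional D"
  shows "continuous_additive_functional (\<lambda>t \<omega>. C t \<omega> + D t \<omega>)"
  unfolding continuous_additive_functional_alt
proof (intro conjI allI ballI)
  fix t show "(\<lambda>\<omega>. C t \<omega> + D t \<omega>) \<in> borel_measurable (F t)"
    using assms unfolding continuous_additive_functional_alt by (intro borel_measurable_add) auto
next
  fix x assume x: "x \<in> states"
  have sum: "regular_path (\<lambda>t \<omega>. C t \<omega> + D t \<omega>) \<omega>"
    if "regular_path C \<omega>" "regular_path D \<omega>" for \<omega>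
    using that unfolding regular_path_def
    by (auto simp: mono_def intro!: add_mono continuous_on_add_ennreal simp: ac_simps)
  have "AE \<omega> in P x. regular_path C \<omega>" "AE \<omega> in P x. regular_path D \<omega>"
    using assms x unfolding continuous_additive_functional_alt by auto
  then show "AE \<omega> in P x. regular_path (\<lambda>t \<omega>. C t \<omega> + D t \<omega>) \<omega>"
    by eventually_elim (rule sum)
qed

lemma continuous_additive_functional_sum:
  assumes "finite I" "\<And>y. y \<in> I \<Longrightarrow> continuous_additive_functional (C y)"
  shows "continuous_additive_functional (\<lambda>t \<omega>. \<Sum>y\<in>I. C y t \<omega>)"
  using assms
  by (induction rule: finite_induct)
     (auto intro: continuous_additive_functional_zero continuous_additive_functional_add)

lemma entry_time_less_iff:
  "entry_time C \<omega> < t \<longleftrightarrow> (\<exists>d\<in>rational_times. d < t \<and> 0 < C d \<omega>)"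
  unfolding entry_time_def Inf_less_iff by auto

text \<open>The upper end \<open>s\<close> confines the condition to times before \<open>s\<close>,
  so that the event lies in \<open>F s\<close> for every \<open>s > t\<close> and right continuity
  of the filtration applies.\<close>

lemma entry_time_le_iff:
  assumes "t < s"
  shows "entry_time C \<omega> \<le> t \<longleftrightarrow> (\<forall>d\<in>rational_times \<inter> {t<..<s}. entry_time C \<omega> < d)"
proof safe
  fix d assume "entry_time C \<omega> \<le> t" "d \<in> {t<..<s}"
  then show "entry_time C \<omega> < d" by auto
next
  assume *: "\<forall>d\<in>rational_times \<inter> {t<..<s}. entry_time C \<omega> < d"
  show "entry_time C \<omega> \<le> t"
  proof (rule ccontr)
    assume "\<not> entry_time C \<omega> \<le> t"
    then have "t < min s (entry_time C \<omega>)" using assms by auto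
    from rational_times_dense[OF this] obtain d where "d \<in> rational_times" "t < d" "d < s" "d < entry_time C \<omega>"
      by auto
    then show False using * by (auto dest!: bspec[of _ _ d])
  qed
qed

lemma entry_time_less_measurable:
  assumes C: "\<And>t. C t \<in> borel_measurable (F t)"
  shows "{\<omega>\<in>\<Omega>. entry_time C \<omega> < t} \<in> sets (F t)"
proof -
  have "{\<omega>\<in>\<Omega>. entry_time C \<omega> < t} = (\<Union>d\<in>rational_times \<inter> {..<t}. {\<omega>\<in>space (F d). 0 < C d \<omega>})"
    by (auto simp: entry_time_less_iff space_F)
  also have "\<dots> \<in> sets (F t)"
  proof (rule sets.countable_UN'')
    show "countable (rational_times \<inter> {..<t})" using countable_rational_times by auto
    fix d assume d: "d \<in> rational_times \<inter> {..<t}"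
    have "{\<omega>\<in>space (F d). 0 < C d \<omega>} \<in> sets (F d)"
      using C[of d] by measurable
    moreover have "sets (F d) \<subseteq> sets (F t)" using d by (intro sets_F_mono) auto
    ultimately show "{\<omega>\<in>space (F d). 0 < C d \<omega>} \<in> sets (F t)" by (rule set_mp[rotated])
  qed
  finally show ?thesis .
qed

lemma stopping_time_entry_time:
  assumes C: "\<And>t. C t \<in> borel_measurable (F t)"
  shows "stopping_time F (entry_time C)"
proof
  fix t
  show "Measurable.pred (F t) (\<lambda>\<omega>. entry_time C \<omega> \<le> t)"
  proof (cases "t = \<infinity>")
    case True then show ?thesis by simp
  next
    case False
    then have t: "t < \<infinity>" by (simp add: less_top)
    have "{\<omega>\<in>\<Omega>. entry_time C \<omega> \<le> t} \<in> sets (F s)" if s: "t < s" for s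
    proof -
      let ?D = "rational_times \<inter> {t<..<s}"
      have "?D \<noteq> {}" using rational_times_dense[OF s] by auto
      have "{\<omega>\<in>\<Omega>. entry_time C \<omega> \<le> t} = (\<Inter>d\<in>?D. {\<omega>\<in>\<Omega>. entry_time C \<omega> < d})"
        using \<open>?D \<noteq> {}\<close> by (auto simp: entry_time_le_iff[OF s])
      also have "\<dots> \<in> sets (F s)"
      proof (rule sets.countable_INT')
        show "countable ?D" using countable_rational_times by auto
        show "?D \<noteq> {}" by fact
        show "(\<lambda>d. {\<omega>\<in>\<Omega>. entry_time C \<omega> < d}) ` ?D \<subseteq> sets (F s)"
        proof clarify
          fix d assume "d \<in> {t<..<s}"
          then have "sets (F d) \<subseteq> sets (F s)" by (intro sets_F_mono) auto
          with entry_time_less_measurable[OF C, of d]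
          show "{\<omega>\<in>\<Omega>. entry_time C \<omega> < d} \<in> sets (F s)" by (rule set_mp[rotated])
        qed
      qed
      finally show ?thesis .
    qed
    then have "{\<omega>\<in>\<Omega>. entry_time C \<omega> \<le> t} \<in> sets (F t)"
      unfolding F_right_continuous[OF t] by auto
    then show ?thesis by (simp add: pred_def space_F)
  qed
qed

context
  fixes C \<omega>
  assumes reg: "regular_path C \<omega>"
begin

lemma pos_after_entry_time:
  assumes "entry_time C \<omega> < t" shows "0 < C t \<omega>"
proof -
  obtain d where d: "d < t" "0 < C d \<omega>" using assms unfolding entry_time_less_iff by auto
  have "C d \<omega> \<le> C t \<omega>" using reg d(1) unfolding regular_path_def mono_def by auto
  with d show ?thesis by auto
qed

text \<open>Left continuity: were \<open>C\<close> positive at its entrance time, it would be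
  positive at some strictly earlier rational time, against the infimum.\<close>

lemma zero_at_entry_time: "C (entry_time C \<omega>) \<omega> = 0"
proof (rule ccontr)
  let ?\<tau> = "entry_time C \<omega>"
  assume "C ?\<tau> \<omega> \<noteq> 0"
  then have pos: "0 < C ?\<tau> \<omega>" by (simp add: zero_less_iff_neq_zero)
  then have "?\<tau> \<noteq> 0" using reg unfolding regular_path_def by auto
  then have "0 < ?\<tau>" by (simp add: zero_less_iff_neq_zero)
  have "open ((\<lambda>t. C t \<omega>) -` {0<..})"
    using reg unfolding regular_path_def by (intro open_vimage) auto
  then obtain b where b: "b < ?\<tau>" "{b<..?\<tau>} \<subseteq> (\<lambda>t. C t \<omega>) -` {0<..}"
    using open_left[of _ ?\<tau> 0] pos \<open>0 < ?\<tau>\<close> by (metis greaterThan_iff vimage_eq)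
  obtain d where d: "d \<in> rational_times" "b < d" "d < ?\<tau>"
    using rational_times_dense[OF b(1)] by auto
  then have "d \<in> {b<..?\<tau>}" by auto
  with b(2) have "0 < C d \<omega>" by auto
  then have "?\<tau> \<le> d" unfolding entry_time_def using d(1) by (intro Inf_lower) auto
  with d(3) show False by simp
qed

text \<open>In the cemetery \<open>C\<close> stays constant. Death at the entrance time would keep
  \<open>C\<close> at 0, whereas it is positive at every later time.\<close>

lemma alive_at_entry_time:
  assumes "entry_time C \<omega> < \<infinity>" shows "Y (entry_time C \<omega>) \<omega> \<noteq> None"
proof
  assume "Y (entry_time C \<omega>) \<omega> = None"
  then have "C \<infinity> \<omega> = C (entry_time C \<omega>) \<omega>"
    using reg unfolding regular_path_def by auto
  with pos_after_entry_time[OF assms] zero_at_entry_time show False by simp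
qed

text \<open>Additivity transfers the immediate growth of \<open>C\<close> after the entrance time to
  the shifted path. With the strong Markov property this restricts the states in which entrance can
  occur.\<close>

lemma entry_time_shift:
  assumes "entry_time C \<omega> < \<infinity>" shows "entry_time C (\<theta> (entry_time C \<omega>) \<omega>) = 0"
proof (rule ccontr)
  let ?\<tau> = "entry_time C \<omega>"
  assume "entry_time C (\<theta> ?\<tau> \<omega>) \<noteq> 0"
  then have "0 < entry_time C (\<theta> ?\<tau> \<omega>)" by (simp add: zero_less_iff_neq_zero)
  then obtain d where d: "d \<in> rational_times" "0 < d" "d < entry_time C (\<theta> ?\<tau> \<omega>)"
    using rational_times_dense by blast
  have "C (?\<tau> + d) \<omega> = C ?\<tau> \<omega> + C d (\<theta> ?\<tau> \<omega>)"
    using reg assms rational_times_finite[OF d(1)] unfolding regular_path_def by auto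
  moreover have "0 < C (?\<tau> + d) \<omega>"
    using assms d(2) by (intro pos_after_entry_time) (cases ?\<tau>; cases d; auto simp: ennreal_less_iff simp flip: ennreal_plus)
  ultimately have "0 < C d (\<theta> ?\<tau> \<omega>)" by (simp add: zero_at_entry_time)
  then have "entry_time C (\<theta> ?\<tau> \<omega>) \<le> d" unfolding entry_time_def using d(1) by (intro Inf_lower) auto
  with d(3) show False by simp
qed

lemma regular_path_tendsto: "(\<lambda>n. C (of_nat n) \<omega>) \<longlonglongrightarrow> C \<infinity> \<omega>"
proof -
  have "isCont (\<lambda>t. C t \<omega>) \<infinity>"
    using reg unfolding regular_path_def by (simp add: continuous_on_eq_continuous_at)
  then show ?thesis
    using isCont_tendsto_compose[OF _ of_nat_tendsto_top_ennreal] by (simp add: infinity_ennreal_def)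
qed

lemma SUP_regular_path: "(SUP n. C (of_nat n) \<omega>) = C \<infinity> \<omega>"
proof (rule LIMSEQ_unique[OF LIMSEQ_SUP regular_path_tendsto])
  show "incseq (\<lambda>n. C (of_nat n) \<omega>)"
    using reg unfolding regular_path_def mono_def by auto
qed

text \<open>Additivity is assumed at finite times only, and the shifted path is not known to be
  regular, so a supremum over integer times replaces the value at \<open>\<infinity>\<close>. It is
  monotone because the finite \<open>C t \<omega>\<close> can be cancelled from the increasing
  \<open>C (t + of_nat n) \<omega>\<close>.\<close>

lemma SUP_regular_path_shift:
  assumes t: "t < \<infinity>"
  shows "C \<infinity> \<omega> = C t \<omega> + (SUP n. C (of_nat n) (\<theta> t \<omega>))"
proof -
  have isC: "isCont (\<lambda>t. C t \<omega>) \<infinity>"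
    using reg unfolding regular_path_def by (simp add: continuous_on_eq_continuous_at)
  have "(\<lambda>n. t + of_nat n) \<longlonglongrightarrow> t + (\<infinity>::ennreal)"
    by (intro tendsto_add tendsto_const) (simp add: infinity_ennreal_def of_nat_tendsto_top_ennreal)
  then have "(\<lambda>n. C (t + of_nat n) \<omega>) \<longlonglongrightarrow> C \<infinity> \<omega>"
    using isCont_tendsto_compose[OF isC] by simp
  moreover have eq: "C (t + of_nat n) \<omega> = C t \<omega> + C (of_nat n) (\<theta> t \<omega>)" for n
    using reg t unfolding regular_path_def by (auto simp: of_nat_less_top)
  have fin: "C t \<omega> < \<infinity>" using reg t unfolding regular_path_def by auto
  have "incseq (\<lambda>n. C (of_nat n) (\<theta> t \<omega>))"
  proof (rule incseq_SucI)
    fix n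
    have "C (t + of_nat n) \<omega> \<le> C (t + of_nat (Suc n)) \<omega>"
      using reg unfolding regular_path_def mono_def by (auto intro!: add_left_mono)
    then show "C (of_nat n) (\<theta> t \<omega>) \<le> C (of_nat (Suc n)) (\<theta> t \<omega>)"
      unfolding eq using fin by (auto simp: ennreal_add_left_cancel_le simp del: of_nat_Suc)
  qed
  then have "(\<lambda>n. C t \<omega> + C (of_nat n) (\<theta> t \<omega>)) \<longlonglongrightarrow> C t \<omega> + (SUP n. C (of_nat n) (\<theta> t \<omega>))"
    by (intro tendsto_add tendsto_const LIMSEQ_SUP)
  ultimately show ?thesis unfolding eq by (rule LIMSEQ_unique)
qed

end

end

section \<open>The strong Markov property at an entrance time\<close>

context strong_markov_process
begin

lemma borel_measurable_A:
  "f \<in> borel_measurable (F t) \<Longrightarrow> f \<in> borel_measurable A"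
  by (rule borel_measurable_subalgebra[OF sets_F_subset]) (simp_all add: space_F space_A)

lemma prob_space_P: "x \<in> states \<Longrightarrow> prob_space (P x)"
  and sets_P: "x \<in> states \<Longrightarrow> sets (P x) = sets A"
  and space_P: "x \<in> states \<Longrightarrow> space (P x) = \<Omega>"
  using P_prob[of x] sets_eq_imp_space_eq[of "P x" A] unfolding states_def by (auto simp: space_A)

lemma state_at_stopping_time_sets:
  assumes "stopping_time F \<tau>" "S \<subseteq> states"
  shows "{\<omega>\<in>\<Omega>. Y (\<tau> \<omega>) \<omega> \<in> S} \<in> sets (pre_sigma \<tau>)"
proof -
  have "(\<lambda>\<omega>. Y (\<tau> \<omega>) \<omega>) -` S \<inter> space (pre_sigma \<tau>) \<in> sets (pre_sigma \<tau>)"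
    using Y_at_stopping_time[OF assms(1)] assms(2)
    by (intro measurable_sets) (auto simp: states_def)
  also have "(\<lambda>\<omega>. Y (\<tau> \<omega>) \<omega>) -` S \<inter> space (pre_sigma \<tau>) = {\<omega>\<in>\<Omega>. Y (\<tau> \<omega>) \<omega> \<in> S}"
    by (auto simp: space_pre_sigma)
  finally show ?thesis .
qed

lemma state_at_stopping_time:
  assumes "stopping_time F \<tau>" "\<omega> \<in> \<Omega>"
  shows "Y (\<tau> \<omega>) \<omega> \<in> states"
  using measurable_space[OF Y_at_stopping_time[OF assms(1)], of \<omega>] assms(2)
  by (simp add: space_pre_sigma states_def)

lemma pre_sigma_finite_shift_sets:
  assumes \<tau>: "stopping_time F \<tau>" and G: "G \<in> sets (pre_sigma \<tau>)" and \<Lambda>: "\<Lambda> \<in> sets A"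
  shows "{\<omega>\<in>G. \<tau> \<omega> < \<infinity> \<and> \<theta> (\<tau> \<omega>) \<omega> \<in> \<Lambda>} \<in> sets A"
proof -
  have "{\<omega>\<in>G. \<tau> \<omega> \<le> \<infinity>} \<in> sets (F \<infinity>)" by (rule sets_pre_sigmaD[OF \<tau> G])
  then have "G \<in> sets A" using sets_F_subset[of \<infinity>] by auto
  moreover have "G \<subseteq> \<Omega>" using sets.sets_into_space[OF \<open>G \<in> sets A\<close>] by (simp add: space_A)
  then have "{\<omega>\<in>G. \<tau> \<omega> < \<infinity> \<and> \<theta> (\<tau> \<omega>) \<omega> \<in> \<Lambda>} = G \<inter> {\<omega>\<in>\<Omega>. \<tau> \<omega> < \<infinity> \<and> \<theta> (\<tau> \<omega>) \<omega> \<in> \<Lambda>}"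
    by auto
  ultimately show ?thesis
    using shift_at_stopping_time[OF \<tau> \<Lambda>] by auto
qed

text \<open>The strong Markov property is given for events. With a fixed state \<open>z\<close> at
  \<open>\<tau>\<close> on \<open>G\<close>, it says that the shift carries \<open>P x\<close>
  restricted to \<open>E\<close> to a multiple of \<open>P z\<close>; \<open>f\<close> is integrated
  against this image.\<close>

lemma strong_markov_integral:
  assumes \<tau>: "stopping_time F \<tau>" and G: "G \<in> sets (pre_sigma \<tau>)"
    and x: "x \<in> states" and z: "z \<in> states"
    and YG: "\<And>\<omega>. \<omega> \<in> G \<Longrightarrow> \<tau> \<omega> < \<infinity> \<Longrightarrow> Y (\<tau> \<omega>) \<omega> = z"
    and f: "f \<in> borel_measurable A"
  defines "E \<equiv> {\<omega>\<in>G. \<tau> \<omega> < \<infinity>}"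
  shows "(\<lambda>\<omega>. f (\<theta> (\<tau> \<omega>) \<omega>) * indicator E \<omega>) \<in> borel_measurable (P x)" (is ?meas)
    and "(\<integral>\<^sup>+\<omega>. f (\<theta> (\<tau> \<omega>) \<omega>) * indicator E \<omega> \<partial>P x) = emeasure (P x) E * (\<integral>\<^sup>+\<omega>. f \<omega> \<partial>P z)"
      (is ?int)
proof -
  interpret P: prob_space "P x" by (rule prob_space_P[OF x])
  let ?N = "restrict_space (P x) E" and ?\<theta> = "\<lambda>\<omega>. \<theta> (\<tau> \<omega>) \<omega>"
  have G\<Omega>: "G \<subseteq> \<Omega>" using sets.sets_into_space[OF G] by (simp add: space_pre_sigma)
  have shift_sets: "{\<omega>\<in>G. \<tau> \<omega> < \<infinity> \<and> ?\<theta> \<omega> \<in> \<Lambda>} \<in> sets (P x)" if "\<Lambda> \<in> sets A" for \<Lambda>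
    using pre_sigma_finite_shift_sets[OF \<tau> G that] by (simp add: sets_P[OF x])
  have "E = {\<omega>\<in>G. \<tau> \<omega> < \<infinity> \<and> ?\<theta> \<omega> \<in> \<Omega>}"
    unfolding E_def using G\<Omega> shift_space by auto
  also have "\<dots> \<in> sets (P x)"
    using shift_sets[OF sets.top] by (simp add: space_A)
  finally have E: "E \<in> sets (P x)" .
  have pre: "?\<theta> -` \<Lambda> \<inter> space ?N = {\<omega>\<in>G. \<tau> \<omega> < \<infinity> \<and> ?\<theta> \<omega> \<in> \<Lambda>}" for \<Lambda>
    using G\<Omega> by (auto simp: E_def space_restrict_space space_P[OF x])
  have \<theta>_meas: "?\<theta> \<in> ?N \<rightarrow>\<^sub>M A"
  proof (rule measurableI)
    fix \<omega> assume "\<omega> \<in> space ?N"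
    then show "?\<theta> \<omega> \<in> space A" by (simp add: space_restrict_space space_P[OF x] space_A shift_space)
  next
    fix \<Lambda> assume "\<Lambda> \<in> sets A"
    from shift_sets[OF this] show "?\<theta> -` \<Lambda> \<inter> space ?N \<in> sets ?N"
      unfolding pre using E by (subst sets_restrict_space_iff) (auto simp: E_def)
  qed
  have distr: "distr ?N A ?\<theta> = scale_measure (emeasure (P x) E) (P z)"
  proof (rule measure_eqI)
    show "sets (distr ?N A ?\<theta>) = sets (scale_measure (emeasure (P x) E) (P z))"
      by (simp add: sets_P[OF z])
    fix \<Lambda> assume "\<Lambda> \<in> sets (distr ?N A ?\<theta>)"
    then have \<Lambda>: "\<Lambda> \<in> sets A" by simp
    have "emeasure (distr ?N A ?\<theta>) \<Lambda> = emeasure (P x) {\<omega>\<in>G. \<tau> \<omega> < \<infinity> \<and> ?\<theta> \<omega> \<in> \<Lambda>}"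
      using E by (subst emeasure_distr[OF \<theta>_meas \<Lambda>], unfold pre, subst emeasure_restrict_space)
         (auto simp: E_def)
    also have "\<dots> = (\<integral>\<^sup>+\<omega>\<in>E. emeasure (P (Y (\<tau> \<omega>) \<omega>)) \<Lambda> \<partial>P x)"
      unfolding E_def using x by (intro strong_markov[OF \<tau> G \<Lambda>]) (simp add: states_def)
    also have "\<dots> = (\<integral>\<^sup>+\<omega>. emeasure (P z) \<Lambda> * indicator E \<omega> \<partial>P x)"
      by (intro nn_integral_cong) (auto simp: indicator_def E_def YG)
    also have "\<dots> = emeasure (P z) \<Lambda> * emeasure (P x) E"
      using E by (simp add: nn_integral_cmult_indicator)
    finally show "emeasure (distr ?N A ?\<theta>) \<Lambda> = emeasure (scale_measure (emeasure (P x) E) (P z)) \<Lambda>"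
      by (simp add: mult.commute)
  qed
  have f\<theta>: "(\<lambda>\<omega>. f (?\<theta> \<omega>)) \<in> borel_measurable ?N"
    by (rule measurable_compose[OF \<theta>_meas f])
  then show ?meas
    using E by (subst (asm) borel_measurable_restrict_space_iff_ennreal) auto
  have "(\<integral>\<^sup>+\<omega>. f (?\<theta> \<omega>) * indicator E \<omega> \<partial>P x) = (\<integral>\<^sup>+\<omega>. f (?\<theta> \<omega>) \<partial>?N)"
    using E by (subst nn_integral_restrict_space) auto
  also have "\<dots> = (\<integral>\<^sup>+\<omega>. f \<omega> \<partial>distr ?N A ?\<theta>)"
    by (rule nn_integral_distr[OF \<theta>_meas, symmetric]) (use f in simp)
  also have "\<dots> = emeasure (P x) E * (\<integral>\<^sup>+\<omega>. f \<omega> \<partial>P z)"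
    unfolding distr using f by (intro nn_integral_scale_measure) (simp add: measurable_cong_sets[OF sets_P[OF z] refl])
  finally show ?int .
qed

text \<open>By \<open>entry_time_shift\<close> the path shifted by the entrance time has entrance
  time 0. Under \<open>P z\<close> with \<open>z \<in> S\<close> this is a null event, so entrance
  in \<open>S\<close> is null by the strong Markov property.\<close>

lemma entry_state:
  assumes C: "continuous_additive_functional C" and x: "x \<in> states"
    and S: "S \<subseteq> states" "\<And>z. z \<in> S \<Longrightarrow> AE \<omega> in P z. 0 < entry_time C \<omega>"
  shows "AE \<omega> in P x. entry_time C \<omega> < \<infinity> \<longrightarrow> Y (entry_time C \<omega>) \<omega> \<notin> S"
proof -
  interpret P: prob_space "P x" by (rule prob_space_P[OF x])
  let ?\<tau> = "entry_time C"
  have meas: "C t \<in> borel_measurable (F t)" for t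
    using C unfolding continuous_additive_functional_alt by auto
  have \<tau>: "stopping_time F ?\<tau>" by (rule stopping_time_entry_time[OF meas])
  define \<Lambda> where "\<Lambda> = {\<omega>\<in>\<Omega>. ?\<tau> \<omega> = 0}"
  define G where "G = {\<omega>\<in>\<Omega>. Y (?\<tau> \<omega>) \<omega> \<in> S}"
  have G: "G \<in> sets (pre_sigma ?\<tau>)"
    unfolding G_def by (rule state_at_stopping_time_sets[OF \<tau> S(1)])
  have "\<Lambda> \<in> sets (F 0)"
    using stopping_timeD[OF \<tau>, of 0] by (simp add: \<Lambda>_def pred_def space_F)
  then have \<Lambda>: "\<Lambda> \<in> sets A" using sets_F_subset by auto
  have "emeasure (P z) \<Lambda> = 0" if "z \<in> S" for z
  proof -
    have "z \<in> states" using that S by auto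
    then show ?thesis
      using S(2)[OF that] \<Lambda>
      by (subst (asm) AE_iff_measurable[of \<Lambda>]) (auto simp: \<Lambda>_def space_P sets_P)
  qed
  then have "(\<integral>\<^sup>+\<omega>\<in>{\<omega>\<in>G. ?\<tau> \<omega> < \<infinity>}. emeasure (P (Y (?\<tau> \<omega>) \<omega>)) \<Lambda> \<partial>P x) = (\<integral>\<^sup>+\<omega>. 0 \<partial>P x)"
    by (intro nn_integral_cong) (auto simp: indicator_def G_def)
  then have 0: "emeasure (P x) {\<omega>\<in>G. ?\<tau> \<omega> < \<infinity> \<and> \<theta> (?\<tau> \<omega>) \<omega> \<in> \<Lambda>} = 0"
    using x by (subst strong_markov[OF \<tau> G \<Lambda>]) (simp_all add: states_def)
  have "{\<omega>\<in>G. ?\<tau> \<omega> < \<infinity> \<and> \<theta> (?\<tau> \<omega>) \<omega> \<in> \<Lambda>} \<in> null_sets (P x)"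
    using 0 pre_sigma_finite_shift_sets[OF \<tau> G \<Lambda>] by (simp add: null_sets_def sets_P[OF x])
  from AE_not_in[OF this] have "AE \<omega> in P x. \<not> (\<omega> \<in> G \<and> ?\<tau> \<omega> < \<infinity> \<and> \<theta> (?\<tau> \<omega>) \<omega> \<in> \<Lambda>)"
    by simp
  moreover have "AE \<omega> in P x. regular_path C \<omega>"
    using C x unfolding continuous_additive_functional_alt by auto
  ultimately show ?thesis
    using AE_space
  proof eventually_elim
    case (elim \<omega>)
    then show ?case
      using entry_time_shift[OF elim(2)] shift_space by (auto simp: G_def \<Lambda>_def space_P[OF x])
  qed
qed

end

section \<open>Balayage and the inverse of the kernel matrix\<close>

context transient_markov_process_with_local_times
begin

lemma local_time_regular:
  assumes "y \<in> T" "x \<in> states" shows "AE \<omega> in P x. regular_path (L y) \<omega>"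
  using local_time[OF assms(1)] assms(2) unfolding local_time_at_def continuous_additive_functional_alt by auto

lemma entry_time_local_times_pos:
  assumes I: "finite I" "I \<subseteq> T" and z: "z \<in> T - I"
  shows "AE \<omega> in P (Some z). 0 < entry_time (\<lambda>t \<omega>. \<Sum>y\<in>I. L y t \<omega>) \<omega>"
proof -
  have "AE \<omega> in P (Some z). \<forall>y\<in>I. 0 < Inf {t. 0 < L y t \<omega>}"
  proof (rule AE_finite_allI[OF I(1)])
    fix y assume "y \<in> I"
    then show "AE \<omega> in P (Some z). 0 < Inf {t. 0 < L y t \<omega>}"
      using local_time[of y] I z unfolding local_time_at_def by auto
  qed
  then show ?thesis
  proof eventually_elim
    case (elim \<omega>)
    let ?R = "\<lambda>y. Inf {t. 0 < L y t \<omega>}" and ?C = "\<lambda>t \<omega>. \<Sum>y\<in>I. L y t \<omega>"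
    \<comment> \<open>The value 1 keeps the set nonempty when \<open>I\<close> is empty.\<close>
    define \<epsilon> where "\<epsilon> = Min (insert 1 (?R ` I))"
    have "0 < \<epsilon>" unfolding \<epsilon>_def using elim I by (subst Min_gr_iff) auto
    have "\<epsilon> \<le> entry_time ?C \<omega>"
    proof (rule ccontr)
      assume "\<not> \<epsilon> \<le> entry_time ?C \<omega>"
      then have "entry_time ?C \<omega> < \<epsilon>" by simp
      then obtain d where d: "d < \<epsilon>" "0 < ?C d \<omega>" unfolding entry_time_less_iff by auto
      then obtain y where y: "y \<in> I" "0 < L y d \<omega>"
        using I(1) by (auto simp: zero_less_iff_neq_zero)
      have "\<epsilon> \<le> ?R y" unfolding \<epsilon>_def using y I by (intro Min_le) auto
      also have "\<dots> \<le> d" using y by (intro Inf_lower) auto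
      finally show False using d by simp
    qed
    with \<open>0 < \<epsilon>\<close> show ?case by simp
  qed
qed

text \<open>Let \<open>\<tau>\<close> be the entrance time of the summed local times of
  \<open>I\<close>, and \<open>h z\<close> the probability of being at \<open>z\<close> at a finite
  \<open>\<tau>\<close>. The local time at \<open>y\<close> splits into the part up to
  \<open>\<tau>\<close> and the part after it, which has expectation
  \<open>\<Sum>z\<in>I. h z * u z y\<close>. The first part vanishes for \<open>y\<close> in
  \<open>I\<close>; for \<open>y = x\<close> it is almost surely positive, whence the strict
  inequality.\<close>

lemma kernel_balayage:
  assumes I: "finite I" "I \<subseteq> T" and x: "x \<in> T" "x \<notin> I"
  obtains h :: "'a \<Rightarrow> real" where "\<And>z. z \<in> I \<Longrightarrow> 0 \<le> h z" "sum h I \<le> 1"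
    "\<And>y. y \<in> I \<Longrightarrow> u x y = (\<Sum>z\<in>I. h z * u z y)" "(\<Sum>z\<in>I. h z * u z x) < u x x"
proof -
  let ?P = "P (Some x)"
  have xs: "Some x \<in> states" and zs: "\<And>z. z \<in> I \<Longrightarrow> Some z \<in> states"
    using x I by (auto simp: states_def)
  interpret P: prob_space ?P by (rule prob_space_P[OF xs])
  define C where "C = (\<lambda>t \<omega>. \<Sum>y\<in>I. L y t \<omega>)"
  define \<tau> where "\<tau> = entry_time C"
  define Z where "Z = (\<lambda>y \<omega>. SUP n. L y (of_nat n) \<omega>)"
  define E where "E = (\<lambda>z. {\<omega>\<in>{\<omega>\<in>\<Omega>. Y (\<tau> \<omega>) \<omega> \<in> {Some z}}. \<tau> \<omega> < \<infinity>})"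
  define h where "h = (\<lambda>z. measure ?P (E z))"
  \<comment> \<open>The local time at \<open>y\<close> after \<open>\<tau>\<close>, split by the
    entrance state so that \<open>strong_markov_integral\<close> applies to each summand.\<close>
  define W where "W = (\<lambda>y \<omega>. \<Sum>z\<in>I. Z y (\<theta> (\<tau> \<omega>) \<omega>) * indicator (E z) \<omega>)"
  have CAF: "continuous_additive_functional C"
    unfolding C_def using I local_time
    by (intro continuous_additive_functional_sum) (auto simp: local_time_at_def)
  have L_meas: "L y t \<in> borel_measurable A" if "y \<in> T" for y t
    using local_time[OF that] borel_measurable_A
    unfolding local_time_at_def continuous_additive_functional_alt by auto
  have L_meas_P: "L y t \<in> borel_measurable ?P" if "y \<in> T" for y t
    using L_meas[OF that] by (simp add: measurable_cong_sets[OF sets_P[OF xs] refl])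
  have Z_meas: "Z y \<in> borel_measurable A" if "y \<in> T" for y
    unfolding Z_def using L_meas[OF that] by measurable
  have Z_int: "(\<integral>\<^sup>+\<omega>. Z y \<omega> \<partial>P (Some z)) = ennreal (u z y)" if "y \<in> T" "z \<in> T" for y z
  proof -
    have "AE \<omega> in P (Some z). regular_path (L y) \<omega>"
      using that by (intro local_time_regular) (auto simp: states_def)
    then have "AE \<omega> in P (Some z). Z y \<omega> = L y \<infinity> \<omega>"
      by eventually_elim (simp add: Z_def SUP_regular_path)
    then have "(\<integral>\<^sup>+\<omega>. Z y \<omega> \<partial>P (Some z)) = (\<integral>\<^sup>+\<omega>. L y \<infinity> \<omega> \<partial>P (Some z))"
      by (rule nn_integral_cong_AE)
    then show ?thesis
      unfolding local_time_normalized[OF that(2,1)] .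
  qed
  have \<tau>: "stopping_time F \<tau>"
    unfolding \<tau>_def using CAF
    by (intro stopping_time_entry_time) (auto simp: continuous_additive_functional_alt)
  have G: "{\<omega>\<in>\<Omega>. Y (\<tau> \<omega>) \<omega> \<in> {Some z}} \<in> sets (pre_sigma \<tau>)" if "z \<in> I" for z
    using zs[OF that] by (intro state_at_stopping_time_sets[OF \<tau>]) auto
  have E_eq: "E z = {\<omega>\<in>{\<omega>\<in>\<Omega>. Y (\<tau> \<omega>) \<omega> \<in> {Some z}}. \<tau> \<omega> < \<infinity>}" for z
    by (simp add: E_def)
  note markov = strong_markov_integral[OF \<tau> G xs zs _ Z_meas, folded E_eq]
  have W_meas: "W y \<in> borel_measurable ?P" if "y \<in> T" for y
    unfolding W_def using that by (intro borel_measurable_sum markov(1)) auto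
  have "(\<integral>\<^sup>+\<omega>. W y \<omega> \<partial>?P) = (\<Sum>z\<in>I. emeasure ?P (E z) * (\<integral>\<^sup>+\<omega>. Z y \<omega> \<partial>P (Some z)))" if "y \<in> T" for y
    unfolding W_def
  proof (subst nn_integral_sum)
    show "(\<lambda>\<omega>. Z y (\<theta> (\<tau> \<omega>) \<omega>) * indicator (E z) \<omega>) \<in> borel_measurable ?P" if "z \<in> I" for z
      using that \<open>y \<in> T\<close> by (intro markov(1)) auto
    show "(\<Sum>z\<in>I. \<integral>\<^sup>+\<omega>. Z y (\<theta> (\<tau> \<omega>) \<omega>) * indicator (E z) \<omega> \<partial>?P) =
        (\<Sum>z\<in>I. emeasure ?P (E z) * (\<integral>\<^sup>+\<omega>. Z y \<omega> \<partial>P (Some z)))"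
      using \<open>y \<in> T\<close> by (intro sum.cong refl markov(2)) auto
  qed
  then have W_int: "(\<integral>\<^sup>+\<omega>. W y \<omega> \<partial>?P) = ennreal (\<Sum>z\<in>I. h z * u z y)" if "y \<in> T" for y
    using that I u_nonneg
    by (simp add: Z_int subset_eq P.emeasure_eq_measure h_def ennreal_mult' flip: sum_ennreal)
  \<comment> \<open>From states of \<open>T - I\<close> the entrance time is almost surely positive,
    which excludes them at \<open>\<tau>\<close>; with \<open>alive_at_entry_time\<close> only
    states of \<open>I\<close> remain.\<close>
  have entry: "AE \<omega> in ?P. \<tau> \<omega> < \<infinity> \<longrightarrow> Y (\<tau> \<omega>) \<omega> \<notin> Some ` (T - I)"
    unfolding \<tau>_def using entry_time_local_times_pos[OF I]
    by (intro entry_state[OF CAF xs]) (auto simp: states_def C_def)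
  have reg: "AE \<omega> in ?P. regular_path C \<omega>"
    using CAF xs unfolding continuous_additive_functional_alt by auto
  have W_eq: "AE \<omega> in ?P. \<forall>y. W y \<omega> = (if \<tau> \<omega> < \<infinity> then Z y (\<theta> (\<tau> \<omega>) \<omega>) else 0)"
    using entry reg AE_space
  proof eventually_elim
    case (elim \<omega>)
    show ?case
    proof (cases "\<tau> \<omega> < \<infinity>")
      case True
      then obtain z where z: "Y (\<tau> \<omega>) \<omega> = Some z" "z \<in> I"
        using elim alive_at_entry_time[OF elim(2)] state_at_stopping_time[OF \<tau>, of \<omega>]
        by (auto simp: \<tau>_def states_def space_P[OF xs])
      then have E_iff: "\<omega> \<in> E z' \<longleftrightarrow> z' = z" for z'
        using elim True by (auto simp: E_def space_P[OF xs])
      have "W y \<omega> = (\<Sum>z'\<in>I. if z' = z then Z y (\<theta> (\<tau> \<omega>) \<omega>) else 0)" for y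
        unfolding W_def by (intro sum.cong) (auto simp: E_iff)
      then show ?thesis
        using True z I(1) by simp
    next
      case False
      then show ?thesis by (auto simp: W_def E_def)
    qed
  qed
  have L_split: "AE \<omega> in ?P. L y \<infinity> \<omega> = L y (\<tau> \<omega>) \<omega> + W y \<omega>" if y: "y \<in> T" for y
    using W_eq local_time_regular[OF y xs]
  proof eventually_elim
    case (elim \<omega>)
    then show ?case
      using SUP_regular_path_shift[OF elim(2), of "\<tau> \<omega>"]
      by (cases "\<tau> \<omega> < \<infinity>") (auto simp: Z_def less_top[symmetric] infinity_ennreal_def)
  qed
  show thesis
  proof
    show "0 \<le> h z" for z by (simp add: h_def)
    have E: "E z \<in> sets ?P" if "z \<in> I" for z
    proof -
      \<comment> \<open>Measurability of \<open>E z\<close> is read off from its indicator, the case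
        of the constant function 1.\<close>
      have "(\<lambda>\<omega>. 1 * indicator (E z) \<omega> :: ennreal) \<in> borel_measurable ?P"
        using strong_markov_integral(1)[OF \<tau> G[OF that] xs zs[OF that], of "\<lambda>_. 1"] by (simp add: E_def)
      then have "(\<lambda>\<omega>. indicator (E z) \<omega> :: ennreal) -` {1} \<inter> space ?P \<in> sets ?P"
        by (intro measurable_sets) auto
      also have "(\<lambda>\<omega>. indicator (E z) \<omega> :: ennreal) -` {1} \<inter> space ?P = E z"
        by (auto simp: indicator_def E_def space_P[OF xs] split: if_splits)
      finally show ?thesis .
    qed
    have "sum h I = measure ?P (\<Union>z\<in>I. E z)"
      unfolding h_def using I E
      by (intro P.finite_measure_finite_Union[symmetric]) (auto simp: disjoint_family_on_def E_def)
    then show "sum h I \<le> 1" by simp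
  next
    fix y assume y: "y \<in> I"
    then have yT: "y \<in> T" using I by auto
    have "AE \<omega> in ?P. L y \<infinity> \<omega> = W y \<omega>"
      using L_split[OF yT] reg
    proof eventually_elim
      case (elim \<omega>)
      have "C (\<tau> \<omega>) \<omega> = 0" unfolding \<tau>_def by (rule zero_at_entry_time[OF elim(2)])
      then have "L y (\<tau> \<omega>) \<omega> = 0" using y I by (simp add: C_def)
      then show ?case using elim by simp
    qed
    then have "(\<integral>\<^sup>+\<omega>. L y \<infinity> \<omega> \<partial>?P) = (\<integral>\<^sup>+\<omega>. W y \<omega> \<partial>?P)" by (rule nn_integral_cong_AE)
    then have "ennreal (u x y) = ennreal (\<Sum>z\<in>I. h z * u z y)"
      using yT by (simp add: W_int local_time_normalized[OF x(1) yT])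
    then show "u x y = (\<Sum>z\<in>I. h z * u z y)"
      using I x yT u_nonneg by (subst (asm) ennreal_inj) (auto intro!: sum_nonneg simp: h_def)
  next
    have pos: "AE \<omega> in ?P. 0 < L x (\<tau> \<omega>) \<omega>"
    proof -
      have "AE \<omega> in ?P. 0 < \<tau> \<omega>"
        unfolding \<tau>_def C_def using I x by (intro entry_time_local_times_pos) auto
      moreover have "AE \<omega> in ?P. Inf {t. 0 < L x t \<omega>} = 0"
        using local_time[OF x(1)] unfolding local_time_at_def by auto
      ultimately show ?thesis
        using local_time_regular[OF x(1) xs]
      proof eventually_elim
        case (elim \<omega>)
        then have "Inf {t. 0 < L x t \<omega>} < \<tau> \<omega>" by simp
        then obtain t where "t < \<tau> \<omega>" "0 < L x t \<omega>" unfolding Inf_less_iff by auto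
        moreover have "L x t \<omega> \<le> L x (\<tau> \<omega>) \<omega>"
          using elim(3) \<open>t < \<tau> \<omega>\<close> unfolding regular_path_def mono_def by auto
        ultimately show ?case by auto
      qed
    qed
    \<comment> \<open>Finite expectation makes \<open>W x\<close> almost surely finite, so that it
      can be cancelled and the comparison of integrals becomes strict.\<close>
    have fin: "(\<integral>\<^sup>+\<omega>. W x \<omega> \<partial>?P) \<noteq> \<infinity>" using W_int[OF x(1)] by simp
    have "(\<integral>\<^sup>+\<omega>. W x \<omega> \<partial>?P) < (\<integral>\<^sup>+\<omega>. L x \<infinity> \<omega> \<partial>?P)"
    proof (rule nn_integral_less[OF W_meas[OF x(1)] L_meas_P[OF x(1)] fin])
      show "AE \<omega> in ?P. W x \<omega> \<le> L x \<infinity> \<omega>"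
        using L_split[OF x(1)] by eventually_elim simp
      show "\<not> (AE \<omega> in ?P. L x \<infinity> \<omega> \<le> W x \<omega>)"
      proof
        assume "AE \<omega> in ?P. L x \<infinity> \<omega> \<le> W x \<omega>"
        then have "AE \<omega> in ?P. False"
          using L_split[OF x(1)] pos nn_integral_noteq_infinite[OF W_meas[OF x(1)] fin]
        proof eventually_elim
          case (elim \<omega>)
          then have "W x \<omega> + L x (\<tau> \<omega>) \<omega> \<le> W x \<omega> + 0" by (simp add: add.commute)
          then show False using elim by (simp only: ennreal_add_left_cancel_le) auto
        qed
        then show False by simp
      qed
    qed
    then have "ennreal (\<Sum>z\<in>I. h z * u z x) < ennreal (u x x)"
      by (simp add: W_int[OF x(1)] local_time_normalized[OF x(1) x(1)])
    then show "(\<Sum>z\<in>I. h z * u z x) < u x x"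
      using ennreal_less_iff ennreal_lessI not_le by (metis ennreal_leI)
  qed
qed

end

text \<open>Row \<open>i\<close> comes from balayage of \<open>ts ! i\<close> onto the other points:
  subtracting from row \<open>i\<close> of the kernel matrix the other rows with weights
  \<open>H i\<close> leaves \<open>c i\<close> on the diagonal and 0 elsewhere. Division by
  \<open>c i\<close> gives row \<open>i\<close> of the left inverse, and weights of total at most 1
  give its nonnegative row sum.\<close>

lemma (in transient_markov_process_with_local_times) kernel_mat_left_inverse:
  assumes ts: "distinct ts" "set ts \<subseteq> T" and n: "n = length ts"
  obtains a :: "nat \<Rightarrow> real" and b :: "nat \<Rightarrow> nat \<Rightarrow> real"
  where "\<And>i. i < n \<Longrightarrow> 0 < a i" "\<And>i j. i < n \<Longrightarrow> j < n \<Longrightarrow> 0 \<le> b i j" "\<And>i. b i i = 0"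
    "\<And>i. i < n \<Longrightarrow> (\<Sum>j<n. b i j) \<le> a i"
    "Matrix.mat n n (\<lambda>(i, j). (if i = j then a i else 0) - b i j) * kernel_mat u ts = 1\<^sub>m n"
proof -
  define I where "I = (\<lambda>i. set ts - {ts ! i})"
  have "\<exists>h. (\<forall>z\<in>I i. 0 \<le> h z) \<and> sum h (I i) \<le> 1 \<and>
      (\<forall>y\<in>I i. u (ts ! i) y = (\<Sum>z\<in>I i. h z * u z y)) \<and>
      (\<Sum>z\<in>I i. h z * u z (ts ! i)) < u (ts ! i) (ts ! i)" if "i < n" for i
  proof -
    have "finite (I i)" "I i \<subseteq> T" "ts ! i \<in> T" "ts ! i \<notin> I i"
      using that ts n unfolding I_def by auto
    from kernel_balayage[OF this] show ?thesis by metis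
  qed
  then have "\<exists>H. \<forall>i. i < n \<longrightarrow> (\<forall>z\<in>I i. 0 \<le> H i z) \<and> sum (H i) (I i) \<le> 1 \<and>
      (\<forall>y\<in>I i. u (ts ! i) y = (\<Sum>z\<in>I i. H i z * u z y)) \<and>
      (\<Sum>z\<in>I i. H i z * u z (ts ! i)) < u (ts ! i) (ts ! i)"
    by (intro choice) blast
  then obtain H where H: "\<And>i z. i < n \<Longrightarrow> z \<in> I i \<Longrightarrow> 0 \<le> H i z"
      "\<And>i. i < n \<Longrightarrow> sum (H i) (I i) \<le> 1"
      "\<And>i y. i < n \<Longrightarrow> y \<in> I i \<Longrightarrow> u (ts ! i) y = (\<Sum>z\<in>I i. H i z * u z y)"
      "\<And>i. i < n \<Longrightarrow> (\<Sum>z\<in>I i. H i z * u z (ts ! i)) < u (ts ! i) (ts ! i)"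
    by blast
  \<comment> \<open>When \<open>H i\<close> is the entrance distribution, this is the expected local
    time at \<open>ts ! i\<close> before entrance into the other points. Its reciprocal becomes a
    diagonal entry of the inverse.\<close>
  define c where "c = (\<lambda>i. u (ts ! i) (ts ! i) - (\<Sum>z\<in>I i. H i z * u z (ts ! i)))"
  \<comment> \<open>\<open>H i\<close> is unconstrained at \<open>ts ! i\<close>, which is not in
    \<open>I i\<close>; hence the separate value 0 on the diagonal.\<close>
  define b where "b = (\<lambda>i j. if i = j then 0 else H i (ts ! j) / c i)"
  have c: "0 < c i" if "i < n" for i using H(4)[OF that] by (simp add: c_def)
  have in_I: "ts ! j \<in> I i" if "i < n" "j < n" "i \<noteq> j" for i j
    using that ts n by (simp add: I_def nth_eq_iff_index_eq)
  have sum_b: "(\<Sum>j<n. b i j * f (ts ! j)) = (\<Sum>z\<in>I i. H i z * f z) / c i" if "i < n" for i f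
  proof -
    have bij: "bij_betw ((!) ts) ({..<n} - {i}) (I i)"
      using that ts n unfolding I_def bij_betw_def inj_on_def
      by (auto simp: nth_eq_iff_index_eq in_set_conv_nth)
    have "(\<Sum>j<n. b i j * f (ts ! j)) = (\<Sum>j\<in>{..<n} - {i}. H i (ts ! j) * f (ts ! j) / c i)"
      using that by (subst sum.remove[of _ i]) (auto simp: b_def intro!: sum.cong)
    also have "\<dots> = (\<Sum>z\<in>I i. H i z * f z / c i)"
      by (rule sum.reindex_bij_betw[OF bij, of "\<lambda>z. H i z * f z / c i"])
    finally show ?thesis by (simp add: sum_divide_distrib)
  qed
  show thesis
  proof (rule that[of "\<lambda>i. 1 / c i" b])
    show "0 < 1 / c i" if "i < n" for i using c[OF that] by simp
    show "0 \<le> b i j" if "i < n" "j < n" for i j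
      using H(1)[OF that(1) in_I[OF that]] c[OF that(1)] by (simp add: b_def)
    show "b i i = 0" for i by (simp add: b_def)
    show "(\<Sum>j<n. b i j) \<le> 1 / c i" if "i < n" for i
      using sum_b[OF that, of "\<lambda>_. 1"] H(2)[OF that] c[OF that] by (simp add: divide_right_mono)
    show "Matrix.mat n n (\<lambda>(i, j). (if i = j then 1 / c i else 0) - b i j) * kernel_mat u ts = 1\<^sub>m n"
    proof (rule eq_matI)
      fix i k assume "i < dim_row (1\<^sub>m n :: real mat)" "k < dim_col (1\<^sub>m n :: real mat)"
      then have ik: "i < n" "k < n" by auto
      have "(Matrix.mat n n (\<lambda>(i, j). (if i = j then 1 / c i else 0) - b i j) * kernel_mat u ts) $$ (i, k)
          = (\<Sum>j<n. ((if i = j then 1 / c i else 0) - b i j) * u (ts ! j) (ts ! k))"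
        using ik n by (simp add: kernel_mat_def scalar_prod_def lessThan_atLeast0)
      also have "\<dots> = (\<Sum>j<n. if i = j then u (ts ! j) (ts ! k) / c i else 0)
          - (\<Sum>j<n. b i j * u (ts ! j) (ts ! k))"
        by (subst sum_subtractf[symmetric]) (auto intro!: sum.cong simp: left_diff_distrib)
      also have "\<dots> = (u (ts ! i) (ts ! k) - (\<Sum>z\<in>I i. H i z * u z (ts ! k))) / c i"
        using ik by (simp add: sum_b[of i "\<lambda>z. u z (ts ! k)"] diff_divide_distrib)
      also have "\<dots> = (if i = k then 1 else 0)"
        using H(3)[OF ik(1) in_I[OF ik]] c[OF ik(1)] by (auto simp: c_def)
      finally show "(Matrix.mat n n (\<lambda>(i, j). (if i = j then 1 / c i else 0) - b i j) * kernel_mat u ts) $$ (i, k)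
          = 1\<^sub>m n $$ (i, k)"
        using ik by simp
    qed (use n in \<open>auto simp: kernel_mat_def\<close>)
  qed
qed

lemma mat_inverse_eqI:
  fixes A :: "real mat"
  assumes A: "A \<in> carrier_mat n n" and B: "B \<in> carrier_mat n n" and BA: "B * A = 1\<^sub>m n"
  shows "mat_inverse A = Some B"
proof -
  have AB: "A * B = 1\<^sub>m n" by (rule mat_mult_left_right_inverse[OF B A BA])
  have "A \<in> Units (ring_mat TYPE(real) n ())"
    using A B AB BA unfolding Units_def by (auto simp: ring_mat_simps)
  then obtain C where C: "mat_inverse A = Some C"
    using mat_inverse(1)[OF A, of "()"] by (cases "mat_inverse A") auto
  from mat_inverse(2)[OF A this] have "A * C = 1\<^sub>m n" "C \<in> carrier_mat n n" by auto
  then have "C = (B * A) * C" using BA by simp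
  also have "\<dots> = B * (A * C)" using A B \<open>C \<in> carrier_mat n n\<close> by (intro assoc_mult_mat) auto
  also have "\<dots> = B" using B \<open>A * C = 1\<^sub>m n\<close> by simp
  finally show ?thesis using C by simp
qed

section \<open>Expansion of the Laplace transform\<close>

text \<open>Describes the factor of the Laplace transform that remains after
  \<open>\<Prod>i<n. (a i + s i) powr (- \<alpha>)\<close> is split off. Nonnegative expansions in
  products of \<open>1 / (a i + s i)\<close> are encoded by closure rules, which replaces
  multi-index bookkeeping by induction. Limits are pointwise at nonnegative \<open>s\<close> only;
  elsewhere the limit function is arbitrary.\<close>

inductive_set gamma_cone :: "(nat \<Rightarrow> real) \<Rightarrow> nat \<Rightarrow> ((nat \<Rightarrow> real) \<Rightarrow> real) set"
  for a :: "nat \<Rightarrow> real" and n :: nat where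
  const: "0 \<le> c \<Longrightarrow> (\<lambda>s. c) \<in> gamma_cone a n"
| divide: "\<phi> \<in> gamma_cone a n \<Longrightarrow> i < n \<Longrightarrow> (\<lambda>s. \<phi> s / (a i + s i)) \<in> gamma_cone a n"
| add: "\<phi> \<in> gamma_cone a n \<Longrightarrow> \<psi> \<in> gamma_cone a n \<Longrightarrow> (\<lambda>s. \<phi> s + \<psi> s) \<in> gamma_cone a n"
| limit: "(\<And>k::nat. \<phi> k \<in> gamma_cone a n) \<Longrightarrow>
    (\<And>s. (\<forall>i. 0 \<le> s i) \<Longrightarrow> (\<lambda>k. \<phi> k s) \<longlonglongrightarrow> \<psi> s) \<Longrightarrow> \<psi> \<in> gamma_cone a n"

lemma gamma_cone_cmult:
  assumes "0 \<le> c" "\<phi> \<in> gamma_cone a n" shows "(\<lambda>s. c * \<phi> s) \<in> gamma_cone a n"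
  using assms(2)
proof induction
  case (const d) then show ?case using assms(1) by (intro gamma_cone.const) simp
next
  case (divide \<phi> i) then show ?case using gamma_cone.divide[OF divide.IH] by simp
next
  case (add \<phi> \<psi>) then show ?case using gamma_cone.add[OF add.IH] by (simp add: distrib_left)
next
  case (limit \<phi> \<psi>)
  show ?case
    by (rule gamma_cone.limit[of "\<lambda>k s. c * \<phi> k s"], rule limit.IH) (intro tendsto_mult tendsto_const limit.hyps)
qed

lemma gamma_cone_mult:
  assumes "\<phi> \<in> gamma_cone a n" "\<psi> \<in> gamma_cone a n" shows "(\<lambda>s. \<phi> s * \<psi> s) \<in> gamma_cone a n"
  using assms(1)
proof induction
  case (const d) then show ?case using assms(2) by (intro gamma_cone_cmult)
next
  case (divide \<phi> i) then show ?case using gamma_cone.divide[OF divide.IH] by simp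
next
  case (add \<phi> \<phi>') then show ?case using gamma_cone.add[OF add.IH] by (simp add: distrib_right)
next
  case (limit \<phi> \<phi>')
  show ?case
    by (rule gamma_cone.limit[of "\<lambda>k s. \<phi> k s * \<psi> s"], rule limit.IH) (intro tendsto_mult tendsto_const limit.hyps)
qed

lemma gamma_cone_power:
  "\<phi> \<in> gamma_cone a n \<Longrightarrow> (\<lambda>s. \<phi> s ^ k) \<in> gamma_cone a n"
proof (induction k)
  case 0 then show ?case using gamma_cone.const[of 1] by simp
next
  case (Suc k) then show ?case using gamma_cone_mult[of \<phi> a n "\<lambda>s. \<phi> s ^ k"] by simp
qed

lemma gamma_cone_sum:
  "finite K \<Longrightarrow> (\<And>k. k \<in> K \<Longrightarrow> \<phi> k \<in> gamma_cone a n) \<Longrightarrow> (\<lambda>s. \<Sum>k\<in>K. \<phi> k s) \<in> gamma_cone a n"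
proof (induction K rule: finite_induct)
  case empty then show ?case using gamma_cone.const[of 0] by simp
next
  case (insert k K)
  then show ?case using gamma_cone.add[of "\<phi> k" a n "\<lambda>s. \<Sum>k\<in>K. \<phi> k s"] by simp
qed

lemma gamma_cone_sums:
  assumes "\<And>k. \<phi> k \<in> gamma_cone a n" "\<And>s. (\<forall>i. 0 \<le> s i) \<Longrightarrow> (\<lambda>k. \<phi> k s) sums \<psi> s"
  shows "\<psi> \<in> gamma_cone a n"
proof (rule gamma_cone.limit[of "\<lambda>m s. \<Sum>k<m. \<phi> k s"])
  show "(\<lambda>s. \<Sum>k<m. \<phi> k s) \<in> gamma_cone a n" for m
    using assms(1) by (intro gamma_cone_sum) auto
  show "(\<lambda>m. \<Sum>k<m. \<phi> k s) \<longlonglongrightarrow> \<psi> s" if "\<forall>i. 0 \<le> s i" for s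
    using assms(2)[OF that] by (simp add: sums_def)
qed

lemma gamma_cone_bounds:
  assumes "\<phi> \<in> gamma_cone a n" "\<And>i. i < n \<Longrightarrow> 0 < a i" "\<forall>i. 0 \<le> s i"
  shows "0 \<le> \<phi> s" "\<phi> s \<le> \<phi> (\<lambda>_. 0)"
proof -
  have "0 \<le> \<phi> s \<and> \<phi> s \<le> \<phi> (\<lambda>_. 0)"
    using assms(1)
  proof induction
    case (divide \<phi> i)
    then have "0 < a i" using assms by auto
    moreover from this have "\<phi> s / (a i + s i) \<le> \<phi> (\<lambda>_. 0) / a i"
      using divide assms(3) by (intro frac_le) auto
    ultimately show ?case using divide assms(3) by (auto intro!: divide_nonneg_pos add_pos_nonneg)
  next
    case (limit \<phi> \<psi>)
    have "0 \<le> \<psi> s"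
      by (rule LIMSEQ_le_const[OF limit.hyps(2)[OF assms(3)]]) (use limit.IH in blast)
    moreover have "\<psi> s \<le> \<psi> (\<lambda>_. 0)"
      by (rule LIMSEQ_le[OF limit.hyps(2)[OF assms(3)] limit.hyps(2)]) (use limit.IH in auto)
    ultimately show ?case ..
  qed auto
  then show "0 \<le> \<phi> s" "\<phi> s \<le> \<phi> (\<lambda>_. 0)" by auto
qed

text \<open>These are the coefficients of the binomial series of
  \<open>(1 - q) powr (- \<alpha>)\<close>: rising factorials of \<open>\<alpha>\<close> divided by
  factorials.\<close>

lemma gchoose_minus_nonneg:
  fixes \<alpha> :: real assumes "0 < \<alpha>" shows "0 \<le> (- \<alpha> gchoose k) * (- 1) ^ k"
proof -
  have "(- \<alpha> gchoose k) * (- 1) ^ k = pochhammer \<alpha> k / fact k"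
    by (simp add: gbinomial_pochhammer mult_ac)
  then show ?thesis using assms by (simp add: pochhammer_nonneg)
qed

context
  fixes a :: "nat \<Rightarrow> real" and n :: nat
  assumes a_pos: "\<And>i. i < n \<Longrightarrow> 0 < a i"
begin

text \<open>Binomial series in \<open>r s / (a m + s m)\<close>, which lies in \<open>[0, 1)\<close>
  for all nonnegative \<open>s\<close> because elements of the cone are largest at 0.\<close>

lemma gamma_cone_pivot_powr:
  assumes r: "r \<in> gamma_cone a n" "r (\<lambda>_. 0) < a m" "m < n" and \<alpha>: "0 < \<alpha>"
  shows "(\<lambda>s. (1 - r s / (a m + s m)) powr (- \<alpha>)) \<in> gamma_cone a n"
proof (rule gamma_cone_sums)
  let ?q = "\<lambda>s. r s / (a m + s m)"
  show "(\<lambda>s. ((- \<alpha> gchoose k) * (- 1) ^ k) * ?q s ^ k) \<in> gamma_cone a n" for k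
    using r \<alpha> by (intro gamma_cone_cmult gamma_cone_power gamma_cone.divide gchoose_minus_nonneg)
  fix s :: "nat \<Rightarrow> real" assume s: "\<forall>i. 0 \<le> s i"
  have "0 \<le> r s" "r s < a m + s m"
    using gamma_cone_bounds[OF r(1) a_pos s] r(2) s[rule_format, of m] by auto
  then have "\<bar>- ?q s\<bar> < 1" by simp
  from gen_binomial_real[OF this, of "- \<alpha>"]
  show "(\<lambda>k. ((- \<alpha> gchoose k) * (- 1) ^ k) * ?q s ^ k) sums (1 - ?q s) powr (- \<alpha>)"
    by (subst (asm) power_minus) (simp add: mult.assoc)
qed

lemma gamma_cone_pivot_inverse:
  assumes r: "r \<in> gamma_cone a n" "r (\<lambda>_. 0) < a m" "m < n"
  shows "(\<lambda>s. 1 / (a m + s m - r s)) \<in> gamma_cone a n"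
\<comment> \<open>The limit rule with a constant sequence replaces a function by one that agrees
  with it only at nonnegative \<open>s\<close>.\<close>
proof (rule gamma_cone.limit)
  have "(\<lambda>s. (1 - r s / (a m + s m)) powr (- 1)) \<in> gamma_cone a n"
    using gamma_cone_pivot_powr[OF r, of 1] by simp
  from gamma_cone.divide[OF this r(3)]
  show "(\<lambda>s. (1 - r s / (a m + s m)) powr (- 1) / (a m + s m)) \<in> gamma_cone a n" for k :: nat .
  fix s :: "nat \<Rightarrow> real" assume s: "\<forall>i. 0 \<le> s i"
  have "0 \<le> r s" "r s < a m + s m" "0 < a m + s m"
    using gamma_cone_bounds[OF r(1) a_pos s] r(2) s[rule_format, of m] by auto
  then have "(1 - r s / (a m + s m)) powr (- 1) / (a m + s m) = 1 / (a m + s m - r s)"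
    by (simp add: powr_minus diff_divide_eq_iff)
  then show "(\<lambda>k. (1 - r s / (a m + s m)) powr (- 1) / (a m + s m)) \<longlonglongrightarrow> 1 / (a m + s m - r s)"
    by simp
qed

end

section \<open>Gaussian elimination on determinants\<close>

lemma det_Suc_schur:
  fixes f :: "nat \<Rightarrow> nat \<Rightarrow> real"
  assumes "f k k \<noteq> 0"
  shows "Determinant.det (Matrix.mat (Suc k) (Suc k) (\<lambda>(i, j). f i j)) =
    f k k * Determinant.det (Matrix.mat k k (\<lambda>(i, j). f i j - f i k * f k j / f k k))"
proof -
  let ?M = "Matrix.mat (Suc k) (Suc k) (\<lambda>(i, j). f i j)"
  let ?M' = "Matrix.mat k k (\<lambda>(i, j). f i j - f i k * f k j / f k k)"
  let ?c = "Matrix.mat k 1 (\<lambda>(i, j). f i k / f k k)"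
  let ?r = "Matrix.mat 1 k (\<lambda>(i, j). f k j)"
  let ?d = "Matrix.mat 1 1 (\<lambda>(i, j). f k k)"
  \<comment> \<open>Block elimination of the last index; \<open>?M'\<close> is the Schur complement
    of the entry \<open>f k k\<close>.\<close>
  let ?U = "four_block_mat (1\<^sub>m k) ?c (0\<^sub>m 1 k) (1\<^sub>m 1)"
  let ?L = "four_block_mat ?M' (0\<^sub>m k 1) ?r ?d"
  have "?U * ?L = four_block_mat (1\<^sub>m k * ?M' + ?c * ?r) (1\<^sub>m k * 0\<^sub>m k 1 + ?c * ?d)
      (0\<^sub>m 1 k * ?M' + 1\<^sub>m 1 * ?r) (0\<^sub>m 1 k * 0\<^sub>m k 1 + 1\<^sub>m 1 * ?d)"
    by (rule mult_four_block_mat) auto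
  also have "\<dots> = ?M"
    using assms by (intro eq_matI) (auto simp: scalar_prod_def less_Suc_eq)
  finally have M: "?M = ?U * ?L" ..
  have "Determinant.det ?M = Determinant.det ?U * Determinant.det ?L"
    unfolding M by (rule Determinant.det_mult[of _ "k + 1"]) auto
  also have "Determinant.det ?U = 1"
    by (subst det_four_block_mat_lower_left_zero[of _ k _ 1]) auto
  also have "Determinant.det ?L = Determinant.det ?M' * Determinant.det ?d"
    by (rule det_four_block_mat_upper_right_zero[of _ k _ 1]) auto
  also have "Determinant.det ?d = f k k"
    by (simp add: det_single)
  finally show ?thesis by simp
qed

text \<open>Gaussian elimination keeps the shape of the matrix: each pivot is \<open>a k + s k\<close> minus an element
  of the cone, so its inverse and its negative powers have expansions with nonnegative
  coefficients.  Elements of the cone decrease in \<open>s\<close>, hence pivots only need to be positive at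
  \<open>s = 0\<close>, where this follows from weak row dominance and invertibility.\<close>

lemma det_powr_gamma_cone:
  fixes a :: "nat \<Rightarrow> real" and b :: "nat \<Rightarrow> nat \<Rightarrow> (nat \<Rightarrow> real) \<Rightarrow> real"
  defines "M \<equiv> \<lambda>k b s. Matrix.mat k k (\<lambda>(i, j). (if i = j then a i + s i else 0) - b i j s)"
  assumes a_pos: "\<And>i. i < n \<Longrightarrow> 0 < a i" and \<alpha>: "0 < \<alpha>" and "k \<le> n"
    and "\<And>i j. i < k \<Longrightarrow> j < k \<Longrightarrow> b i j \<in> gamma_cone a n"
    and "\<And>i. i < k \<Longrightarrow> (\<Sum>j<k. b i j (\<lambda>_. 0)) \<le> a i"
    and "Determinant.det (M k b (\<lambda>_. 0)) \<noteq> 0"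
  shows "\<exists>g\<in>gamma_cone a n. \<forall>s. (\<forall>i. 0 \<le> s i) \<longrightarrow> 0 < Determinant.det (M k b s) \<and>
    Determinant.det (M k b s) powr (- \<alpha>) = (\<Prod>i<k. (a i + s i) powr (- \<alpha>)) * g s"
  using assms(4-)
proof (induction k arbitrary: b)
  case 0
  then show ?case by (intro bexI[of _ "\<lambda>_. 1"]) (auto simp: M_def gamma_cone.const)
next
  case (Suc k)
  let ?o = "\<lambda>_::nat. 0::real"
  define d where "d = (\<lambda>s. a k + s k - b k k s)"
  \<comment> \<open>The Schur complement leaves \<open>a i + s i\<close> in place and adds cone
    elements to \<open>b\<close>, on the diagonal as well; this is why the induction admits diagonal
    entries of \<open>b\<close>.\<close>
  define b' where "b' = (\<lambda>i j s. b i j s + b i k s * b k j s / d s)"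
  have b_cone: "b i j \<in> gamma_cone a n" if "i < Suc k" "j < Suc k" for i j
    using that Suc.prems by auto
  note b_bounds = gamma_cone_bounds[OF b_cone a_pos]
  have row: "(\<Sum>j<k. b k j ?o) \<le> d ?o"
    using Suc.prems(3)[of k] by (simp add: d_def)
  have b0: "0 \<le> b i j ?o" if "i < Suc k" "j < Suc k" for i j
    using b_bounds(1)[OF that] by auto
  \<comment> \<open>With a zero pivot, row dominance would force the whole last row to vanish, and
    with it the determinant.\<close>
  have "d ?o \<noteq> 0"
  proof
    assume d0: "d ?o = 0"
    have "(\<Sum>j<k. b k j ?o) = 0"
      using row d0 b0 by (intro antisym sum_nonneg) auto
    then have z: "b k j ?o = 0" if "j < k" for j
      using that b0 by (subst (asm) sum_nonneg_eq_0_iff) auto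
    have "Determinant.det (M (Suc k) b ?o) = (\<Sum>j<Suc k. M (Suc k) b ?o $$ (k, j) * cofactor (M (Suc k) b ?o) k j)"
      by (rule laplace_expansion_row) (auto simp: M_def)
    also have "\<dots> = 0"
      using z d0 by (intro sum.neutral) (auto simp: M_def d_def less_Suc_eq)
    finally show False using Suc.prems by simp
  qed
  moreover have "0 \<le> d ?o" using row b0 by (intro order_trans[OF _ row] sum_nonneg) auto
  ultimately have d0: "0 < d ?o" by simp
  have d_pos: "0 < d s" if "\<forall>i. 0 \<le> s i" for s
  proof -
    have "0 \<le> s k" using that by blast
    moreover have "b k k s \<le> b k k ?o" using b_bounds(2)[of k k s] that by simp
    ultimately show ?thesis using d0 unfolding d_def by linarith
  qed
  have bkk: "b k k ?o < a k" using d0 by (simp add: d_def)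
  have "k < n" using Suc.prems by simp
  have d_inv: "(\<lambda>s. 1 / d s) \<in> gamma_cone a n"
    using gamma_cone_pivot_inverse[OF a_pos b_cone[of k k] bkk \<open>k < n\<close>] by (simp add: d_def)
  have b'_cone: "b' i j \<in> gamma_cone a n" if "i < k" "j < k" for i j
    using gamma_cone.add[OF b_cone gamma_cone_mult[OF gamma_cone_mult[OF b_cone b_cone] d_inv], of i j i k k j] that
    by (simp add: b'_def)
  have det_M: "Determinant.det (M (Suc k) b s) = d s * Determinant.det (M k b' s)" if "\<forall>i. 0 \<le> s i" for s
  proof -
    let ?f = "\<lambda>i j. (if i = j then a i + s i else 0) - b i j s"
    have "?f k k = d s" by (simp add: d_def)
    moreover have "M k b' s = Matrix.mat k k (\<lambda>(i, j). ?f i j - ?f i k * ?f k j / ?f k k)"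
      by (rule eq_matI) (auto simp: M_def b'_def d_def)
    ultimately show ?thesis
      using det_Suc_schur[of ?f k] d_pos[OF that] by (simp add: M_def)
  qed
  \<comment> \<open>Elimination spreads \<open>b i k\<close> over the columns \<open>j < k\<close>
    with weights \<open>b k j / d\<close>, whose sum is at most 1 by \<open>row\<close>; so row
    dominance survives.\<close>
  have row': "(\<Sum>j<k. b' i j ?o) \<le> a i" if i: "i < k" for i
  proof -
    have "(\<Sum>j<k. b' i j ?o) = (\<Sum>j<k. b i j ?o) + b i k ?o * ((\<Sum>j<k. b k j ?o) / d ?o)"
      by (simp add: b'_def sum.distrib sum_distrib_left sum_divide_distrib)
    also have "\<dots> \<le> (\<Sum>j<k. b i j ?o) + b i k ?o * 1"
      using row d0 b0[of i k] i by (intro add_left_mono mult_left_mono) auto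
    also have "\<dots> \<le> a i" using Suc.prems(3)[of i] i by simp
    finally show ?thesis .
  qed
  have "Determinant.det (M k b' ?o) \<noteq> 0"
    using det_M[of ?o] Suc.prems(4) by auto
  from Suc.IH[OF _ b'_cone row' this] Suc.prems(1) obtain g where g: "g \<in> gamma_cone a n"
    and det_g: "\<And>s. (\<forall>i. 0 \<le> s i) \<Longrightarrow> 0 < Determinant.det (M k b' s) \<and>
      Determinant.det (M k b' s) powr (- \<alpha>) = (\<Prod>i<k. (a i + s i) powr (- \<alpha>)) * g s"
    by auto
  show ?case
  proof (intro bexI allI impI)
    \<comment> \<open>The pivot is \<open>a k + s k\<close> times
      \<open>1 - b k k s / (a k + s k)\<close>. The power of the first factor goes into the product,
      that of the second into the cone.\<close>
    show "(\<lambda>s. (1 - b k k s / (a k + s k)) powr (- \<alpha>) * g s) \<in> gamma_cone a n"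
      by (intro gamma_cone_mult gamma_cone_pivot_powr a_pos b_cone bkk \<open>k < n\<close> \<alpha> g) auto
    fix s :: "nat \<Rightarrow> real" assume s: "\<forall>i. 0 \<le> s i"
    have ak: "0 < a k + s k" using a_pos[OF \<open>k < n\<close>] s by (simp add: add_pos_nonneg)
    have d_eq: "d s = (a k + s k) * (1 - b k k s / (a k + s k))"
      using ak by (simp add: d_def field_simps)
    have "0 < 1 - b k k s / (a k + s k)"
      using d_pos[OF s] ak unfolding d_eq by (simp add: zero_less_mult_iff)
    then have "d s powr (- \<alpha>) = (a k + s k) powr (- \<alpha>) * (1 - b k k s / (a k + s k)) powr (- \<alpha>)"
      unfolding d_eq using ak by (intro powr_mult)
    then show "0 < Determinant.det (M (Suc k) b s) \<and> Determinant.det (M (Suc k) b s) powr (- \<alpha>) =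
      (\<Prod>i<Suc k. (a i + s i) powr (- \<alpha>)) * ((1 - b k k s / (a k + s k)) powr (- \<alpha>) * g s)"
      using det_g[OF s] d_pos[OF s] by (simp add: det_M[OF s] powr_mult)
  qed
qed

text \<open>With \<open>A\<close> the inverse of \<open>K\<close>, the matrix \<open>I + K S\<close>
  is \<open>K (A + S)\<close>, and \<open>A + S\<close> has the shape treated by elimination. The
  constant \<open>det K powr (- \<alpha>)\<close> is absorbed into \<open>g\<close>.\<close>

lemma (in transient_markov_process_with_local_times) permanental_laplace_gamma_cone:
  assumes \<alpha>: "0 < \<alpha>" and X: "permanental_process M T \<alpha> u X"
    and ts: "distinct ts" "set ts \<subseteq> T" and n: "n = length ts"
  obtains a g where "\<And>i. i < n \<Longrightarrow> 0 < a i"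
    "diag_mat (the (mat_inverse (kernel_mat u ts))) = map a [0..<n]" "g \<in> gamma_cone a n"
    "\<And>s. (\<forall>i. 0 \<le> s i) \<Longrightarrow> (\<integral>\<omega>. exp (- (\<Sum>i<n. s i * X (ts ! i) \<omega>)) \<partial>M)
       = (\<Prod>i<n. (a i + s i) powr (- \<alpha>)) * g s"
proof -
  obtain a b where a: "\<And>i. i < n \<Longrightarrow> 0 < a i" and b: "\<And>i j. i < n \<Longrightarrow> j < n \<Longrightarrow> 0 \<le> b i j"
    and bii: "\<And>i. b i i = 0" and row: "\<And>i. i < n \<Longrightarrow> (\<Sum>j<n. b i j) \<le> a i"
    and inv: "Matrix.mat n n (\<lambda>(i, j). (if i = j then a i else 0) - b i j) * kernel_mat u ts = 1\<^sub>m n"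
    using kernel_mat_left_inverse[OF ts n] by blast
  define K where "K = kernel_mat u ts"
  define A where "A = Matrix.mat n n (\<lambda>(i, j). (if i = j then a i else 0) - b i j)"
  define B where "B = (\<lambda>s. Matrix.mat n n (\<lambda>(i, j). (if i = j then a i + s i else 0) - b i j))"
  have B_eq: "B s = Matrix.mat n n (\<lambda>(i, j). (if i = j then a i + s i else 0) - b i j)" for s
    by (simp add: B_def)
  have K: "K \<in> carrier_mat n n" and A: "A \<in> carrier_mat n n" and B: "B s \<in> carrier_mat n n" for s
    using n by (auto simp: K_def A_def B_def kernel_mat_def)
  have AK: "A * K = 1\<^sub>m n" using inv by (simp add: A_def K_def)
  have KA: "K * A = 1\<^sub>m n" by (rule mat_mult_left_right_inverse[OF A K AK])
  have B0: "B (\<lambda>_. 0) = A" by (rule eq_matI) (auto simp: A_def B_def)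
  have det_KA: "Determinant.det K * Determinant.det A = 1"
    using KA by (simp flip: Determinant.det_mult[OF K A])
  have "Determinant.det (B (\<lambda>_. 0)) \<noteq> 0" using det_KA by (auto simp: B0)
  then obtain g where g: "g \<in> gamma_cone a n"
    and det_B: "\<And>s. (\<forall>i. 0 \<le> s i) \<Longrightarrow> 0 < Determinant.det (B s) \<and>
      Determinant.det (B s) powr (- \<alpha>) = (\<Prod>i<n. (a i + s i) powr (- \<alpha>)) * g s"
    using det_powr_gamma_cone[of n a \<alpha> n "\<lambda>i j s. b i j",
        OF a \<alpha> order.refl gamma_cone.const[OF b] row, folded B_eq]
    by blast
  \<comment> \<open>\<open>det A\<close> is positive by \<open>det_B\<close> at
    \<open>s = 0\<close>, and \<open>det K\<close> is its reciprocal. Positive factors are what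
    allows the power of the product to be split.\<close>
  have det_K: "0 < Determinant.det K"
    using det_KA det_B[of "\<lambda>_. 0"] zero_less_mult_pos2[of "Determinant.det K" "Determinant.det A"]
    unfolding B0 by simp
  have det_KS: "Determinant.det (1\<^sub>m n + K * mat_diag n s) = Determinant.det K * Determinant.det (B s)" for s
  proof -
    have "B s = A + mat_diag n s" by (rule eq_matI) (auto simp: A_def B_def mat_diag_def)
    then have "K * B s = 1\<^sub>m n + K * mat_diag n s"
      by (simp add: mult_add_distrib_mat[OF K A] KA)
    then show ?thesis using Determinant.det_mult[OF K B, of s] by simp
  qed
  show thesis
  proof (rule that)
    show "diag_mat (the (mat_inverse (kernel_mat u ts))) = map a [0..<n]"
      unfolding mat_inverse_eqI[OF K A AK, unfolded K_def] by (simp add: diag_mat_def A_def bii)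
    show "(\<lambda>s. Determinant.det K powr (- \<alpha>) * g s) \<in> gamma_cone a n"
      by (intro gamma_cone_cmult g) simp
    fix s :: "nat \<Rightarrow> real" assume s: "\<forall>i. 0 \<le> s i"
    have "(\<integral>\<omega>. exp (- (\<Sum>i<n. s i * X (ts ! i) \<omega>)) \<partial>M)
        = Determinant.det (1\<^sub>m n + K * mat_diag n s) powr (- \<alpha>)"
      using X n[symmetric] ts(2) s unfolding permanental_process_def K_def by (simp only: simp_thms)
    also have "\<dots> = (Determinant.det K * Determinant.det (B s)) powr (- \<alpha>)"
      by (simp add: det_KS)
    also have "\<dots> = Determinant.det K powr (- \<alpha>) * Determinant.det (B s) powr (- \<alpha>)"
      using det_K det_B[OF s] by (intro powr_mult)
    finally show "(\<integral>\<omega>. exp (- (\<Sum>i<n. s i * X (ts ! i) \<omega>)) \<partial>M)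
        = (\<Prod>i<n. (a i + s i) powr (- \<alpha>)) * (Determinant.det K powr (- \<alpha>) * g s)"
      using det_B[OF s] by simp
  qed (use a in auto)
qed

text \<open>The left-hand side is the expectation of a product of functions of the coordinates with
  signed weights, so it is not monotone in \<open>\<phi>\<close>; the inequality is nevertheless preserved by all
  closure rules of the cone once the exponents \<open>\<kappa>\<close> are allowed to vary.\<close>

lemma gamma_cone_weighted_sum_le:
  fixes a m :: "nat \<Rightarrow> real" and c :: "nat \<Rightarrow> real" and \<alpha> r :: real
  assumes a: "\<And>i. i < n \<Longrightarrow> 0 < a i" and r: "0 \<le> r"
    and nonneg: "\<And>i k. i < n \<Longrightarrow> 0 \<le> (\<Sum>j\<le>N. c j * (a i + r * real j) powr (- (\<alpha> + real k)))"
    and le: "\<And>i k. i < n \<Longrightarrow> (\<Sum>j\<le>N. c j * (a i + r * real j) powr (- (\<alpha> + real k)))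
      \<le> m i * a i powr (- (\<alpha> + real k))"
    and \<phi>: "\<phi> \<in> gamma_cone a n"
  shows "(\<Sum>J\<in>PiE {..<n} (\<lambda>_. {..N}).
      (\<Prod>i<n. c (J i) * (a i + r * real (J i)) powr (- (\<alpha> + real (\<kappa> i)))) * \<phi> (\<lambda>i. r * real (J i)))
    \<le> (\<Prod>i<n. m i * a i powr (- (\<alpha> + real (\<kappa> i)))) * \<phi> (\<lambda>_. 0)"
    (is "(\<Sum>J\<in>?P. ?w \<kappa> J * _) \<le> ?m \<kappa> * _")
  using \<phi>
proof (induction arbitrary: \<kappa>)
  case (const d)
  have "(\<Sum>J\<in>?P. ?w \<kappa> J) = (\<Prod>i<n. \<Sum>j\<le>N. c j * (a i + r * real j) powr (- (\<alpha> + real (\<kappa> i))))"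
    by (subst prod_sum_PiE) auto
  also have "\<dots> \<le> ?m \<kappa>" by (intro prod_mono conjI nonneg le) auto
  finally show ?case using const by (simp add: mult_right_mono flip: sum_distrib_right)
next
  case (divide \<phi> l)
  \<comment> \<open>Division by \<open>a l + s l\<close> raises the exponent of coordinate
    \<open>l\<close> by one, both at \<open>s i = r * J i\<close> and at 0, so the induction
    hypothesis is used with these exponents.\<close>
  let ?\<kappa> = "\<kappa>(l := Suc (\<kappa> l))"
  have shift: "(\<Prod>i<n. f i * x i powr (- (\<alpha> + real (\<kappa> i)))) / x l
      = (\<Prod>i<n. f i * x i powr (- (\<alpha> + real (?\<kappa> i))))" if "0 < x l" for f x :: "nat \<Rightarrow> real"
  proof -
    let ?R = "\<Prod>i\<in>{..<n} - {l}. f i * x i powr (- (\<alpha> + real (\<kappa> i)))"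
    have "- (\<alpha> + real (?\<kappa> l)) = - (\<alpha> + real (\<kappa> l)) - 1" by simp
    then have "x l powr (- (\<alpha> + real (?\<kappa> l))) = x l powr (- (\<alpha> + real (\<kappa> l))) / x l"
      using that by (simp only: powr_diff) simp
    moreover have "(\<Prod>i<n. f i * x i powr (- (\<alpha> + real (\<kappa> i))))
        = f l * x l powr (- (\<alpha> + real (\<kappa> l))) * ?R"
      using divide.hyps(2) by (intro prod.remove) auto
    moreover have "(\<Prod>i<n. f i * x i powr (- (\<alpha> + real (?\<kappa> i))))
        = f l * x l powr (- (\<alpha> + real (?\<kappa> l))) * ?R"
      using divide.hyps(2) by (subst prod.remove[of _ l]) (auto intro!: prod.cong)
    ultimately show ?thesis by simp
  qed
  have w: "?w \<kappa> J / (a l + r * real (J l)) = ?w ?\<kappa> J" for J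
    using a[OF divide.hyps(2)] r by (intro shift) (simp add: add_pos_nonneg)
  have m: "?m \<kappa> / a l = ?m ?\<kappa>"
    by (intro shift a divide.hyps)
  have "(\<Sum>J\<in>?P. ?w \<kappa> J * (\<phi> (\<lambda>i. r * real (J i)) / (a l + r * real (J l))))
      = (\<Sum>J\<in>?P. ?w ?\<kappa> J * \<phi> (\<lambda>i. r * real (J i)))"
    by (intro sum.cong refl) (simp only: w[symmetric] times_divide_eq_left times_divide_eq_right)
  also have "\<dots> \<le> ?m ?\<kappa> * \<phi> (\<lambda>_. 0)" by (rule divide.IH)
  also have "\<dots> = ?m \<kappa> * (\<phi> (\<lambda>_. 0) / (a l + 0))"
    by (simp only: m[symmetric] times_divide_eq_left times_divide_eq_right add_0_right)
  finally show ?case .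
next
  case (add \<phi> \<psi>)
  show ?case
    using add_mono[OF add.IH(1)[of \<kappa>] add.IH(2)[of \<kappa>]]
    by (simp add: distrib_left sum.distrib)
next
  case (limit \<phi> \<psi>)
  show ?case
  proof (rule LIMSEQ_le)
    show "(\<lambda>k. \<Sum>J\<in>?P. ?w \<kappa> J * \<phi> k (\<lambda>i. r * real (J i)))
        \<longlonglongrightarrow> (\<Sum>J\<in>?P. ?w \<kappa> J * \<psi> (\<lambda>i. r * real (J i)))"
      using r by (intro tendsto_sum tendsto_mult tendsto_const limit.hyps) auto
    show "(\<lambda>k. ?m \<kappa> * \<phi> k (\<lambda>_. 0)) \<longlonglongrightarrow> ?m \<kappa> * \<psi> (\<lambda>_. 0)"
      by (intro tendsto_mult tendsto_const limit.hyps) auto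
  qed (use limit.IH in blast)
qed

section \<open>Laplace transforms of gamma densities\<close>

text \<open>The gamma density of shape \<open>\<beta>\<close> and rate \<open>b\<close> without its
  normalising constant, so that multiplication by an exponential only changes the rate.\<close>

definition gamma_weight :: "real \<Rightarrow> real \<Rightarrow> real \<Rightarrow> real" where
  "gamma_weight \<beta> b y = indicator {0..} y * y powr (\<beta> - 1) * exp (- b * y)"

lemma gamma_weight_nonneg: "0 \<le> gamma_weight \<beta> b y"
  by (simp add: gamma_weight_def)

lemma has_bochner_integral_gamma_weight:
  assumes \<beta>: "0 < \<beta>" and b: "0 < b"
  shows "has_bochner_integral lborel (gamma_weight \<beta> b) (Gamma \<beta> * b powr (- \<beta>))"
proof (rule has_bochner_integral_nn_integral)
  let ?f = "\<lambda>y. ennreal (indicator {0..} y * y powr (\<beta> - 1) / exp y)"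
  have G: "0 < Gamma \<beta>" using \<beta> by (rule Gamma_real_pos)
  show "gamma_weight \<beta> b \<in> borel_measurable lborel" unfolding gamma_weight_def by measurable
  show "AE y in lborel. 0 \<le> gamma_weight \<beta> b y" by (simp add: gamma_weight_nonneg)
  show "0 \<le> Gamma \<beta> * b powr (- \<beta>)" using G by simp
  have scale: "?f (0 + b * y) = ennreal (b powr (\<beta> - 1)) * ennreal (gamma_weight \<beta> b y)" for y
    using b by (auto simp: gamma_weight_def indicator_def zero_le_mult_iff powr_mult exp_minus field_simps
        ennreal_mult'[symmetric] intro!: arg_cong[of _ _ ennreal])
  have "ennreal (Gamma \<beta>) = (\<integral>\<^sup>+y. ?f y \<partial>lborel)"
    using Gamma_conv_nn_integral_real[OF \<beta>] by simp
  also have "\<dots> = ennreal b * (\<integral>\<^sup>+y. ?f (0 + b * y) \<partial>lborel)"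
    using b by (subst nn_integral_real_affine[of _ b 0]) auto
  also have "\<dots> = ennreal b * (\<integral>\<^sup>+y. ennreal (b powr (\<beta> - 1)) * ennreal (gamma_weight \<beta> b y) \<partial>lborel)"
    by (simp only: scale)
  also have "\<dots> = ennreal b * (ennreal (b powr (\<beta> - 1)) * (\<integral>\<^sup>+y. ennreal (gamma_weight \<beta> b y) \<partial>lborel))"
    by (subst nn_integral_cmult) (auto simp: gamma_weight_def)
  also have "\<dots> = ennreal (b powr \<beta>) * (\<integral>\<^sup>+y. ennreal (gamma_weight \<beta> b y) \<partial>lborel)"
    using b by (simp add: powr_diff field_simps flip: mult.assoc ennreal_mult')
  finally have eq: "ennreal (Gamma \<beta>) = ennreal (b powr \<beta>) * (\<integral>\<^sup>+y. ennreal (gamma_weight \<beta> b y) \<partial>lborel)" .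
  have "ennreal (Gamma \<beta> * b powr (- \<beta>)) = ennreal (b powr (- \<beta>)) * ennreal (Gamma \<beta>)"
    using G by (simp add: ennreal_mult' mult.commute)
  also have "\<dots> = (\<integral>\<^sup>+y. ennreal (gamma_weight \<beta> b y) \<partial>lborel)"
    unfolding eq using b by (simp add: powr_minus flip: mult.assoc ennreal_mult')
  finally show "(\<integral>\<^sup>+y. ennreal (gamma_weight \<beta> b y) \<partial>lborel) = ennreal (Gamma \<beta> * b powr (- \<beta>))" ..
qed

text \<open>The factor \<open>exp (- r * y) ^ j\<close> raises the rate from \<open>a\<close> to
  \<open>a + r * real j\<close>. The sums in the weighted inequality thus become integrals of
  polynomials in \<open>exp (- r * y)\<close>, whose sign is visible pointwise.\<close>

lemma has_bochner_integral_gamma_exp_sum: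
  fixes d :: "nat \<Rightarrow> real"
  assumes \<beta>: "0 < \<beta>" and a: "0 < a" and r: "0 \<le> r"
  shows "has_bochner_integral lborel (\<lambda>y. gamma_weight \<beta> a y * (\<Sum>j\<le>N. d j * exp (- r * y) ^ j))
    (Gamma \<beta> * (\<Sum>j\<le>N. d j * (a + r * real j) powr (- \<beta>)))"
proof -
  have "has_bochner_integral lborel (\<lambda>y. \<Sum>j\<le>N. d j * gamma_weight \<beta> (a + r * real j) y)
    (\<Sum>j\<le>N. d j * (Gamma \<beta> * (a + r * real j) powr (- \<beta>)))"
    using a r \<beta>
    by (intro has_bochner_integral_sum has_bochner_integral_mult_right has_bochner_integral_gamma_weight)
       (auto intro: add_pos_nonneg)
  also have "(\<lambda>y. \<Sum>j\<le>N. d j * gamma_weight \<beta> (a + r * real j) y)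
      = (\<lambda>y. gamma_weight \<beta> a y * (\<Sum>j\<le>N. d j * exp (- r * y) ^ j))"
  proof
    fix y
    have "gamma_weight \<beta> (a + r * real j) y = gamma_weight \<beta> a y * exp (- r * y) ^ j" for j
      by (simp add: gamma_weight_def mult.assoc mult_exp_exp flip: exp_of_nat_mult) (simp add: algebra_simps)
    then show "(\<Sum>j\<le>N. d j * gamma_weight \<beta> (a + r * real j) y)
      = gamma_weight \<beta> a y * (\<Sum>j\<le>N. d j * exp (- r * y) ^ j)"
      by (simp add: sum_distrib_left mult_ac)
  qed
  also have "(\<Sum>j\<le>N. d j * (Gamma \<beta> * (a + r * real j) powr (- \<beta>)))
      = Gamma \<beta> * (\<Sum>j\<le>N. d j * (a + r * real j) powr (- \<beta>))"
    by (simp add: sum_distrib_left mult_ac)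
  finally show ?thesis .
qed

lemma gamma_exp_sum_nonneg:
  fixes d :: "nat \<Rightarrow> real"
  assumes \<beta>: "0 < \<beta>" and a: "0 < a" and r: "0 \<le> r"
    and d: "\<And>z. 0 \<le> z \<Longrightarrow> z \<le> 1 \<Longrightarrow> 0 \<le> (\<Sum>j\<le>N. d j * z ^ j)"
  shows "0 \<le> (\<Sum>j\<le>N. d j * (a + r * real j) powr (- \<beta>))"
proof -
  have nonneg: "0 \<le> gamma_weight \<beta> a y * (\<Sum>j\<le>N. d j * exp (- r * y) ^ j)" for y
  proof (cases "0 \<le> y")
    case True
    then show ?thesis using r by (intro mult_nonneg_nonneg gamma_weight_nonneg d) auto
  qed (simp add: gamma_weight_def)
  have "0 \<le> Gamma \<beta> * (\<Sum>j\<le>N. d j * (a + r * real j) powr (- \<beta>))"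
    unfolding has_bochner_integral_integral_eq[OF has_bochner_integral_gamma_exp_sum[OF \<beta> a r], symmetric]
    by (intro Bochner_Integration.integral_nonneg nonneg)
  then show ?thesis using Gamma_real_pos[OF \<beta>] by (simp add: zero_le_mult_iff)
qed

text \<open>These weights represent the function \<open>1 - (1 - z) ^ N\<close> with \<open>z = exp (- r * y)\<close>: the
  probability that the maximum of \<open>N\<close> independent exponential variables with rate \<open>r\<close> exceeds \<open>y\<close>,
  used as a smooth substitute for the indicator of an interval \<open>{0..x}\<close>.\<close>

definition max_weight :: "nat \<Rightarrow> nat \<Rightarrow> real" where
  "max_weight N j = (if j = 0 then 1 else 0) - real (N choose j) * (- 1) ^ j"

lemma binomial_alternating_sum:
  fixes z :: real
  shows "(\<Sum>j\<le>N. real (N choose j) * (- 1) ^ j * z ^ j) = (1 - z) ^ N"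
  using binomial_ring[of "- z" 1 N]
  by (simp add: power_minus[of z] mult.assoc add.commute)

lemma max_weight_sum: "(\<Sum>j\<le>N. max_weight N j * z ^ j) = 1 - (1 - z) ^ N"
proof -
  have "(\<Sum>j\<le>N. max_weight N j * z ^ j)
      = (\<Sum>j\<le>N. if j = 0 then z ^ j else 0) - (\<Sum>j\<le>N. real (N choose j) * (- 1) ^ j * z ^ j)"
    unfolding max_weight_def sum_subtractf[symmetric] by (intro sum.cong) (auto simp: left_diff_distrib)
  then show ?thesis by (simp add: binomial_alternating_sum)
qed

text \<open>The sum is \<open>z\<close> times the derivative of \<open>1 - (1 - z) ^ N\<close>. Its
  sign is what later compares gamma variables of different shapes.\<close>

lemma max_weight_deriv_nonneg:
  assumes z: "0 \<le> z" "z \<le> 1"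
  shows "0 \<le> (\<Sum>j\<le>N. max_weight N j * real j * z ^ j)"
proof -
  have "((\<lambda>z. \<Sum>j\<le>N. max_weight N j * z ^ j) has_field_derivative
      (\<Sum>j\<le>N. max_weight N j * (real j * z ^ (j - 1)))) (at z)"
    by (auto intro!: derivative_eq_intros sum.cong)
  moreover have "((\<lambda>z. 1 - (1 - z) ^ N) has_field_derivative real N * (1 - z) ^ (N - 1)) (at z)"
    by (auto intro!: derivative_eq_intros)
  ultimately have "(\<Sum>j\<le>N. max_weight N j * (real j * z ^ (j - 1))) = real N * (1 - z) ^ (N - 1)"
    unfolding max_weight_sum by (rule DERIV_unique)
  moreover have "(\<Sum>j\<le>N. max_weight N j * real j * z ^ j) = z * (\<Sum>j\<le>N. max_weight N j * (real j * z ^ (j - 1)))"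
    unfolding sum_distrib_left
  proof (intro sum.cong refl)
    fix j show "max_weight N j * real j * z ^ j = z * (max_weight N j * (real j * z ^ (j - 1)))"
      by (cases j) simp_all
  qed
  ultimately show ?thesis using z by simp
qed

text \<open>For \<open>z = a * y \<ge> 1\<close> one has
  \<open>z powr (\<alpha> - 1) \<ge> 1 / z \<ge> exp (- z)\<close>, for small and large
  \<open>\<alpha>\<close> alike; the power is absorbed by doubling the rate.\<close>

lemma gamma_weight_tail:
  assumes \<alpha>: "0 < \<alpha>" and a: "0 < a" and y: "1 / a \<le> y"
  shows "a powr (1 - \<alpha>) * exp (- (2 * a) * y) \<le> gamma_weight \<alpha> a y"
proof -
  define z where "z = a * y"
  have z: "1 \<le> z" using a y by (simp add: z_def field_simps)
  have y_eq: "y = z / a" using a by (simp add: z_def)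
  have "0 \<le> y" unfolding y_eq using a z by simp
  have "exp (- z) \<le> 1 / z"
  proof -
    have "z \<le> exp z" using exp_ge_add_one_self[of z] by linarith
    then show ?thesis using z by (simp add: exp_minus divide_simps)
  qed
  also have "\<dots> = z powr (- 1)" using z by (simp add: powr_minus_divide)
  also have "\<dots> \<le> z powr (\<alpha> - 1)" using z \<alpha> by (intro powr_mono) auto
  finally have "exp (- z) \<le> z powr (\<alpha> - 1)" .
  then have "a powr (1 - \<alpha>) * (exp (- z) * exp (- z)) \<le> a powr (1 - \<alpha>) * (z powr (\<alpha> - 1) * exp (- z))"
    by (intro mult_left_mono mult_right_mono) auto
  moreover have "y powr (\<alpha> - 1) = a powr (1 - \<alpha>) * z powr (\<alpha> - 1)"
    unfolding y_eq using z a by (simp add: powr_divide powr_minus_divide[of a "\<alpha> - 1", simplified])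
  moreover have "exp (- (2 * a) * y) = exp (- z) * exp (- z)"
    by (simp add: z_def flip: exp_add)
  ultimately show ?thesis using \<open>0 \<le> y\<close> by (simp add: gamma_weight_def z_def)
qed

text \<open>Beyond \<open>Y\<close> the complementary function
  \<open>(1 - exp (- r * y)) ^ N\<close> is at least 1/2, so its integral against the gamma weight
  is at least half of a tail integral, which \<open>gamma_weight_tail\<close> bounds below.\<close>

lemma max_weight_tail:
  assumes \<alpha>: "0 < \<alpha>" and a: "0 < a" and r: "0 \<le> r" and Y: "0 \<le> Y"
    and half: "\<And>y. Y \<le> y \<Longrightarrow> 1 / 2 \<le> (1 - exp (- r * y)) ^ N"
  shows "(\<Sum>j\<le>N. max_weight N j * (a + r * real j) powr (- \<alpha>))
    \<le> (1 - exp (- 2) / (4 * Gamma \<alpha>) * exp (- (2 * a) * Y)) * a powr (- \<alpha>)"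
proof -
  \<comment> \<open>The shift by \<open>1 / a\<close> makes \<open>gamma_weight_tail\<close>
    applicable and costs the factor \<open>exp (- 2)\<close>. The 4 combines the 1/2 from
    \<open>half\<close> with the 2 in the rate \<open>2 * a\<close>.\<close>
  define Z where "Z = Y + 1 / a"
  let ?d = "\<lambda>j. real (N choose j) * (- 1) ^ j"
  let ?S = "\<Sum>j\<le>N. ?d j * (a + r * real j) powr (- \<alpha>)"
  have G: "0 < Gamma \<alpha>" using \<alpha> by (rule Gamma_real_pos)
  have int1: "has_bochner_integral lborel (\<lambda>y. gamma_weight \<alpha> a y * (1 - exp (- r * y)) ^ N) (Gamma \<alpha> * ?S)"
    using has_bochner_integral_gamma_exp_sum[OF \<alpha> a r, of ?d N] unfolding binomial_alternating_sum .
  have "has_bochner_integral lborel (\<lambda>y. indicator {Z..} y * exp (- (2 * a) * y)) (exp (- (2 * a) * Z) / (2 * a))"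
  proof (rule has_bochner_integral_nn_integral)
    show "(\<integral>\<^sup>+y. ennreal (indicator {Z..} y * exp (- (2 * a) * y)) \<partial>lborel) = ennreal (exp (- (2 * a) * Z) / (2 * a))"
      using a by (intro nn_integral_has_integral_lebesgue has_integral_exp_minus_to_infinity) auto
  qed (use a in auto)
  then have int2: "has_bochner_integral lborel
      (\<lambda>y. a powr (1 - \<alpha>) / 2 * (indicator {Z..} y * exp (- (2 * a) * y)))
      (a powr (1 - \<alpha>) / 2 * (exp (- (2 * a) * Z) / (2 * a)))"
    by (intro has_bochner_integral_mult_right)
  have "a powr (1 - \<alpha>) / 2 * (exp (- (2 * a) * Z) / (2 * a)) \<le> Gamma \<alpha> * ?S"
    unfolding has_bochner_integral_integral_eq[OF int1, symmetric] has_bochner_integral_integral_eq[OF int2, symmetric]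
  proof (intro integral_mono)
    fix y :: real
    show "a powr (1 - \<alpha>) / 2 * (indicator {Z..} y * exp (- (2 * a) * y))
        \<le> gamma_weight \<alpha> a y * (1 - exp (- r * y)) ^ N"
    proof (cases "Z \<le> y")
      case True
      then have y: "1 / a \<le> y" "Y \<le> y" using a Y by (auto simp: Z_def intro: order_trans[rotated])
      have "(a powr (1 - \<alpha>) * exp (- (2 * a) * y)) * (1 / 2) \<le> gamma_weight \<alpha> a y * (1 - exp (- r * y)) ^ N"
        using gamma_weight_tail[OF \<alpha> a y(1)] half[OF y(2)] by (intro mult_mono gamma_weight_nonneg) auto
      then show ?thesis using True by simp
    next
      case False
      have "0 \<le> gamma_weight \<alpha> a y * (1 - exp (- r * y)) ^ N"
      proof (cases "0 \<le> y")
        case True then show ?thesis using r by (intro mult_nonneg_nonneg gamma_weight_nonneg) auto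
      qed (simp add: gamma_weight_def)
      then show ?thesis using False by simp
    qed
  qed (use int1 int2 in \<open>auto simp: has_bochner_integral_iff\<close>)
  moreover have "a powr (1 - \<alpha>) / 2 * (exp (- (2 * a) * Z) / (2 * a))
      = exp (- 2) / 4 * exp (- (2 * a) * Y) * a powr (- \<alpha>)"
  proof -
    have "- (2 * a) * Z = - 2 + - (2 * a) * Y" using a by (simp add: Z_def field_simps)
    moreover have "a powr (1 - \<alpha>) = a * a powr (- \<alpha>)" using a by (simp add: powr_diff powr_minus_divide)
    ultimately show ?thesis using a by (simp only: exp_add) simp
  qed
  ultimately have S: "exp (- 2) / (4 * Gamma \<alpha>) * exp (- (2 * a) * Y) * a powr (- \<alpha>) \<le> ?S"
    using G by (simp add: field_simps)
  have "(\<Sum>j\<le>N. max_weight N j * (a + r * real j) powr (- \<alpha>))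
      = (\<Sum>j\<le>N. if j = 0 then a powr (- \<alpha>) else 0) - ?S"
    unfolding max_weight_def sum_subtractf[symmetric] by (intro sum.cong) (auto simp: left_diff_distrib)
  then show ?thesis using S by (simp add: left_diff_distrib)
qed

text \<open>\<open>m\<close> is the mean of \<open>1 - (1 - exp (- r * G)) ^ N\<close> for a gamma
  variable \<open>G\<close> of shape \<open>\<alpha>\<close> and rate \<open>a\<close>. A larger
  shape makes \<open>G\<close> larger and this decreasing function smaller; in terms of sums,
  \<open>?S k - a * ?S (Suc k)\<close> is nonnegative by
  \<open>max_weight_deriv_nonneg\<close>.\<close>

lemma max_weight_gamma_mean:
  fixes N k :: nat
  assumes \<alpha>: "0 < \<alpha>" and a: "0 < a" and r: "0 \<le> r"
  defines "m \<equiv> a powr \<alpha> * (\<Sum>j\<le>N. max_weight N j * (a + r * real j) powr (- \<alpha>))"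
  shows "0 \<le> (\<Sum>j\<le>N. max_weight N j * (a + r * real j) powr (- (\<alpha> + real k)))"
    and "(\<Sum>j\<le>N. max_weight N j * (a + r * real j) powr (- (\<alpha> + real k))) \<le> m * a powr (- (\<alpha> + real k))"
proof -
  let ?S = "\<lambda>k. \<Sum>j\<le>N. max_weight N j * (a + r * real j) powr (- (\<alpha> + real k))"
  show "0 \<le> ?S k"
    using \<alpha> a r by (intro gamma_exp_sum_nonneg) (auto simp: max_weight_sum power_le_one)
  show "?S k \<le> m * a powr (- (\<alpha> + real k))"
  proof (induction k)
    case 0
    have "m * a powr (- \<alpha>) = (a powr \<alpha> * a powr (- \<alpha>)) * ?S 0" by (simp add: m_def)
    moreover have "a powr \<alpha> * a powr (- \<alpha>) = 1" using a by (simp flip: powr_add)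
    ultimately show ?case by simp
  next
    case (Suc k)
    have exps: "- (\<alpha> + real k) = 1 + - (\<alpha> + real (Suc k))" by simp
    have "(\<Sum>j\<le>N. (max_weight N j * real j) * (a + r * real j) powr (- (\<alpha> + real (Suc k)))) \<ge> 0"
      using \<alpha> a r by (intro gamma_exp_sum_nonneg max_weight_deriv_nonneg) auto
    then have "0 \<le> r * (\<Sum>j\<le>N. (max_weight N j * real j) * (a + r * real j) powr (- (\<alpha> + real (Suc k))))"
      using r by simp
    also have "\<dots> = ?S k - a * ?S (Suc k)"
      unfolding sum_distrib_left sum_subtractf[symmetric]
    proof (intro sum.cong refl)
      fix j
      have "0 < a + r * real j" using a r by (simp add: add_pos_nonneg)
      then have "(a + r * real j) powr (- (\<alpha> + real k))
          = (a + r * real j) * (a + r * real j) powr (- (\<alpha> + real (Suc k)))"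
        unfolding exps powr_add by simp
      then show "r * (max_weight N j * real j * (a + r * real j) powr - (\<alpha> + real (Suc k))) =
         max_weight N j * (a + r * real j) powr - (\<alpha> + real k) -
         a * (max_weight N j * (a + r * real j) powr - (\<alpha> + real (Suc k)))"
        by (simp only:) (simp add: algebra_simps)
    qed
    finally have "a * ?S (Suc k) \<le> m * a powr (- (\<alpha> + real k))" using Suc.IH by simp
    also have "\<dots> = a * (m * a powr (- (\<alpha> + real (Suc k))))"
      unfolding exps powr_add using a by simp
    finally show ?case using a by (simp only: mult_le_cancel_left_pos)
  qed
qed

section \<open>The maximum of a permanental vector\<close>

lemma le_card_if_sorted_nth_le:
  fixes xs :: "'a::linorder list"
  assumes k: "1 \<le> k" "k \<le> length xs" and le: "sort xs ! (k - 1) \<le> b"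
  shows "k \<le> card {i. i < length xs \<and> xs ! i \<le> b}"
proof -
  have "length (filter (\<lambda>x. x \<le> b) (take k (sort xs))) = length (take k (sort xs))"
  proof (intro arg_cong[of _ _ length] filter_True ballI)
    fix x assume "x \<in> set (take k (sort xs))"
    then obtain i where i: "i < k" "x = sort xs ! i" using k by (auto simp: in_set_conv_nth)
    have "sort xs ! i \<le> sort xs ! (k - 1)" using i k by (intro sorted_nth_mono) auto
    with i le show "x \<le> b" by simp
  qed
  then have "k \<le> length (filter (\<lambda>x. x \<le> b) (take k (sort xs) @ drop k (sort xs)))"
    using k unfolding filter_append by simp
  also have "\<dots> = length (filter (\<lambda>x. x \<le> b) xs)"
    by (simp add: filter_sort)
  finally show ?thesis by (simp add: length_filter_conv_card)
qed

text \<open>By Bernoulli it suffices that \<open>2 * n \<le> exp n\<close>. The bound keeps a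
  product of \<open>n\<close> near-indicators away from 0.\<close>

lemma one_minus_exp_minus_power_ge_half:
  assumes "0 < n" shows "1 / 2 \<le> (1 - exp (- real n)) ^ n"
proof -
  have "0 \<le> (real n - 1)\<^sup>2" by simp
  then have "2 * real n \<le> 1 + real n + (real n)\<^sup>2 / 2" by (simp add: power2_diff)
  also have "\<dots> \<le> exp (real n)" by (rule exp_lower_Taylor_quadratic) simp
  finally have "1 / 2 \<le> 1 + real n * (- exp (- real n))" by (simp add: exp_minus field_simps)
  also have "\<dots> \<le> (1 + (- exp (- real n))) ^ n" by (rule Bernoulli_inequality) simp
  finally show ?thesis by simp
qed

text \<open>The expectation of \<open>\<Prod>i<n. ?f (X (ts ! i) \<omega>)\<close> is at least half
  the probability in question and at most the product of the gamma means \<open>m i\<close>, which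
  are at most 1, and at most \<open>exp (- q)\<close> for rates up to \<open>b\<close>.\<close>

lemma (in transient_markov_process_with_local_times) permanental_max_le:
  fixes x b :: real
  assumes \<alpha>: "0 < \<alpha>" and X: "permanental_process M T \<alpha> u X"
    and ts: "distinct ts" "set ts \<subseteq> T" "ts \<noteq> []" and x: "0 < x"
  defines "D \<equiv> diag_mat (the (mat_inverse (kernel_mat u ts)))"
  defines "q \<equiv> exp (- 2) / (4 * Gamma \<alpha>) * exp (- (4 * x * b))"
  shows "measure M {\<omega>\<in>space M. \<forall>t\<in>set ts. X t \<omega> \<le> x} \<le> 2 * exp (- q * real (card {i. i < length D \<and> D ! i \<le> b}))"
    and "length D = length ts" "\<And>d. d \<in> set D \<Longrightarrow> 0 < d"
proof -
  define n where "n = length ts"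
  have n: "0 < n" using ts by (simp add: n_def)
  obtain a g where a: "\<And>i. i < n \<Longrightarrow> 0 < a i" and D: "D = map a [0..<n]" and g: "g \<in> gamma_cone a n"
    and laplace: "\<And>s. (\<forall>i. 0 \<le> s i) \<Longrightarrow> (\<integral>\<omega>. exp (- (\<Sum>i<n. s i * X (ts ! i) \<omega>)) \<partial>M)
       = (\<Prod>i<n. (a i + s i) powr (- \<alpha>)) * g s"
    using permanental_laplace_gamma_cone[OF \<alpha> X ts(1,2) n_def] unfolding D_def by blast
  show "length D = length ts" "\<And>d. d \<in> set D \<Longrightarrow> 0 < d"
    using a by (auto simp: D n_def)
  interpret prob_space M using X by (simp add: permanental_process_def)
  have tsT: "ts ! i \<in> T" if "i < n" for i using that ts(2) by (auto simp: n_def)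
  have X_meas: "X (ts ! i) \<in> borel_measurable M" if "i < n" for i
    using X tsT[OF that] by (auto simp: permanental_process_def)
  have X_nonneg: "0 \<le> X (ts ! i) \<omega>" if "i < n" "\<omega> \<in> space M" for i \<omega>
    using X tsT[OF that(1)] that(2) by (auto simp: permanental_process_def)
  \<comment> \<open>Chosen so that \<open>?f\<close> drops between \<open>x\<close> and
    \<open>2 * x\<close>: \<open>N * exp (- r * x) = n\<close> yields \<open>f_near\<close>, and
    \<open>N * exp (- r * (2 * x)) = 1 / 2\<close> yields \<open>f_far\<close>.\<close>
  define r where "r = ln (2 * real n) / x"
  define N where "N = 2 * n\<^sup>2"
  have r: "0 \<le> r" using n x by (simp add: r_def)
  have exp_rx: "exp (- r * x) = 1 / (2 * real n)"
    using n x by (simp add: r_def exp_minus divide_simps)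
  let ?f = "\<lambda>y. 1 - (1 - exp (- r * y)) ^ N"
  let ?P = "PiE {..<n} (\<lambda>_. {..N})"
  let ?c = "max_weight N"
  have f_nonneg: "0 \<le> ?f y" if "0 \<le> y" for y using that r by (simp add: power_le_one)
  have f_near: "1 - exp (- real n) \<le> ?f y" if "0 \<le> y" "y \<le> x" for y
  proof -
    have "exp (- r * x) \<le> exp (- r * y)" using that r by (simp add: mult_left_mono)
    then have "1 - exp (- r * y) \<le> 1 + - (1 / (2 * real n))" unfolding exp_rx by simp
    also have "\<dots> \<le> exp (- (1 / (2 * real n)))" by (rule exp_ge_add_one_self)
    finally have "(1 - exp (- r * y)) ^ N \<le> exp (- (1 / (2 * real n))) ^ N"
      using that r by (intro power_mono) auto
    also have "\<dots> = exp (- real n)"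
      using n by (simp add: N_def power2_eq_square flip: exp_of_nat_mult)
    finally show ?thesis by simp
  qed
  have f_far: "1 / 2 \<le> (1 - exp (- r * y)) ^ N" if "2 * x \<le> y" for y
  proof -
    have "exp (- r * y) \<le> exp (- r * (2 * x))" using that r by (simp add: mult_left_mono)
    also have "\<dots> = exp (- r * x) * exp (- r * x)" by (simp flip: exp_add)
    finally have e: "exp (- r * y) \<le> 1 / (4 * (real n)\<^sup>2)"
      unfolding exp_rx by (simp add: power2_eq_square)
    have "real N * exp (- r * y) \<le> real N * (1 / (4 * (real n)\<^sup>2))"
      using e by (intro mult_left_mono) auto
    also have "\<dots> = 1 / 2" using n by (simp add: N_def)
    finally have "1 / 2 \<le> 1 + real N * (- exp (- r * y))" by simp
    also have "\<dots> \<le> (1 + (- exp (- r * y))) ^ N"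
      using that x r by (intro Bernoulli_inequality) auto
    finally show ?thesis by simp
  qed
  define m where "m = (\<lambda>i. a i powr \<alpha> * (\<Sum>j\<le>N. ?c j * (a i + r * real j) powr (- \<alpha>)))"
  have m_nonneg: "0 \<le> m i" if "i < n" for i
    using max_weight_gamma_mean(1)[OF \<alpha> a[OF that] r, of N 0] by (simp add: m_def)
  have m_le: "m i \<le> 1 - exp (- 2) / (4 * Gamma \<alpha>) * exp (- (4 * x * a i))" if i: "i < n" for i
  proof -
    have "m i \<le> a i powr \<alpha> * ((1 - exp (- 2) / (4 * Gamma \<alpha>) * exp (- (2 * a i) * (2 * x))) * a i powr (- \<alpha>))"
      unfolding m_def using x f_far a[OF i] by (intro mult_left_mono max_weight_tail \<alpha> r) auto
    also have "\<dots> = (a i powr \<alpha> * a i powr (- \<alpha>)) * (1 - exp (- 2) / (4 * Gamma \<alpha>) * exp (- (2 * a i) * (2 * x)))"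
      by simp
    also have "a i powr \<alpha> * a i powr (- \<alpha>) = 1" using a[OF i] by (simp flip: powr_add)
    finally show ?thesis by (simp add: mult_ac)
  qed
  have G: "0 < Gamma \<alpha>" using \<alpha> by (rule Gamma_real_pos)
  have m_le': "m i \<le> (if a i \<le> b then exp (- q) else 1)" if i: "i < n" for i
  proof (cases "a i \<le> b")
    case True
    then have "exp (- (4 * x * b)) \<le> exp (- (4 * x * a i))" using x by simp
    then have "q \<le> exp (- 2) / (4 * Gamma \<alpha>) * exp (- (4 * x * a i))"
      unfolding q_def using G by (intro mult_left_mono) auto
    then have "m i \<le> 1 + (- q)" using m_le[OF i] by simp
    also have "\<dots> \<le> exp (- q)" by (rule exp_ge_add_one_self)
    finally show ?thesis using True by simp
  next
    case False
    have "0 \<le> exp (- 2) / (4 * Gamma \<alpha>) * exp (- (4 * x * a i))" using G by simp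
    then show ?thesis using False m_le[OF i] by simp
  qed
  have int_exp: "integrable M (\<lambda>\<omega>. exp (- (\<Sum>i<n. s i * X (ts ! i) \<omega>)))" if "\<forall>i. 0 \<le> s i" for s
  proof (rule integrable_const_bound[of _ 1])
    show "AE \<omega> in M. norm (exp (- (\<Sum>i<n. s i * X (ts ! i) \<omega>))) \<le> 1"
      using that X_nonneg by (intro AE_I2) (auto intro!: sum_nonneg)
    show "(\<lambda>\<omega>. exp (- (\<Sum>i<n. s i * X (ts ! i) \<omega>))) \<in> borel_measurable M"
      using X_meas by auto
  qed
  have expand: "(\<Prod>i<n. ?f (X (ts ! i) \<omega>))
      = (\<Sum>J\<in>?P. (\<Prod>i<n. ?c (J i)) * exp (- (\<Sum>i<n. (r * real (J i)) * X (ts ! i) \<omega>)))" for \<omega>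
  proof -
    have "(\<Prod>i<n. ?f (X (ts ! i) \<omega>)) = (\<Prod>i<n. \<Sum>j\<le>N. ?c j * exp (- r * X (ts ! i) \<omega>) ^ j)"
      by (simp only: max_weight_sum)
    also have "\<dots> = (\<Sum>J\<in>?P. \<Prod>i<n. ?c (J i) * exp (- r * X (ts ! i) \<omega>) ^ J i)"
      by (intro prod_sum_PiE) auto
    also have "\<dots> = (\<Sum>J\<in>?P. (\<Prod>i<n. ?c (J i)) * exp (- (\<Sum>i<n. (r * real (J i)) * X (ts ! i) \<omega>)))"
      by (intro sum.cong refl) (simp add: prod.distrib exp_sum mult_ac flip: exp_of_nat_mult sum_negf)
    finally show ?thesis .
  qed
  have int_f: "integrable M (\<lambda>\<omega>. \<Prod>i<n. ?f (X (ts ! i) \<omega>))"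
    unfolding expand using r by (intro Bochner_Integration.integrable_sum integrable_mult_right int_exp) auto
  have "(\<integral>\<omega>. (\<Prod>i<n. ?f (X (ts ! i) \<omega>)) \<partial>M)
      = (\<Sum>J\<in>?P. (\<Prod>i<n. ?c (J i)) * ((\<Prod>i<n. (a i + r * real (J i)) powr (- \<alpha>)) * g (\<lambda>i. r * real (J i))))"
    unfolding expand using r int_exp
    by (subst Bochner_Integration.integral_sum) (auto simp: laplace intro!: integrable_mult_right)
  also have "\<dots> = (\<Sum>J\<in>?P. (\<Prod>i<n. ?c (J i) * (a i + r * real (J i)) powr (- (\<alpha> + real 0))) * g (\<lambda>i. r * real (J i)))"
    by (simp add: prod.distrib mult.assoc)
  also have "\<dots> \<le> (\<Prod>i<n. m i * a i powr (- (\<alpha> + real 0))) * g (\<lambda>_. 0)"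
    unfolding m_def using a
    by (intro gamma_cone_weighted_sum_le[where \<kappa> = "\<lambda>_. 0"] r g max_weight_gamma_mean \<alpha>)
  also have "\<dots> = (\<Prod>i<n. m i) * ((\<Prod>i<n. (a i + 0) powr (- \<alpha>)) * g (\<lambda>_. 0))"
    by (simp add: prod.distrib)
  \<comment> \<open>The Laplace transform is 1 at \<open>s = 0\<close>, which eliminates the unknown
    constant \<open>g (\<lambda>_. 0)\<close>.\<close>
  also have "(\<Prod>i<n. (a i + 0) powr (- \<alpha>)) * g (\<lambda>_. 0) = 1"
    by (subst laplace[of "\<lambda>_. 0", symmetric]) (auto simp: prob_space)
  also have "(\<Prod>i<n. m i) * 1 \<le> (\<Prod>i<n. if a i \<le> b then exp (- q) else 1)"
    unfolding mult_1_right by (intro prod_mono) (use m_nonneg m_le' in auto)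
  also have "\<dots> = exp (- q) ^ card {i\<in>{..<n}. a i \<le> b}"
    by (subst prod.inter_filter[symmetric]) auto
  also have "{i\<in>{..<n}. a i \<le> b} = {i. i < length D \<and> D ! i \<le> b}" by (auto simp: D)
  finally have upper: "(\<integral>\<omega>. (\<Prod>i<n. ?f (X (ts ! i) \<omega>)) \<partial>M) \<le> exp (- q) ^ card {i. i < length D \<and> D ! i \<le> b}" .
  let ?E = "{\<omega>\<in>space M. \<forall>t\<in>set ts. X t \<omega> \<le> x}"
  have "?E = {\<omega>\<in>space M. \<forall>i\<in>{..<n}. X (ts ! i) \<omega> \<le> x}"
    by (auto simp: n_def all_set_conv_all_nth)
  also have "\<dots> \<in> sets M"
    by (rule sets.sets_Collect_finite_All) (use X_meas in auto)
  finally have E: "?E \<in> sets M" .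
  have "measure M ?E / 2 = (\<integral>\<omega>. indicator ?E \<omega> * (1 / 2) \<partial>M)"
    using E by simp
  also have "\<dots> \<le> (\<integral>\<omega>. (\<Prod>i<n. ?f (X (ts ! i) \<omega>)) \<partial>M)"
  proof (intro integral_mono int_f)
    show "integrable M (\<lambda>\<omega>. indicator ?E \<omega> * (1 / 2 :: real))"
      using E by (intro integrable_mult_left integrable_real_indicator) (auto simp: less_top[symmetric])
    fix \<omega> assume \<omega>: "\<omega> \<in> space M"
    show "indicator ?E \<omega> * (1 / 2) \<le> (\<Prod>i<n. ?f (X (ts ! i) \<omega>))"
    proof (cases "\<omega> \<in> ?E")
      case True
      have "1 / 2 \<le> (\<Prod>i<n. 1 - exp (- real n))"
        using one_minus_exp_minus_power_ge_half[OF n] by simp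
      also have "\<dots> \<le> (\<Prod>i<n. ?f (X (ts ! i) \<omega>))"
      proof (intro prod_mono conjI)
        fix i assume "i \<in> {..<n}"
        then show "1 - exp (- real n) \<le> ?f (X (ts ! i) \<omega>)"
          using True by (intro f_near X_nonneg) (auto simp: n_def)
      qed simp
      finally show ?thesis using True by simp
    next
      case False
      moreover have "0 \<le> (\<Prod>i<n. ?f (X (ts ! i) \<omega>))"
        by (intro prod_nonneg ballI f_nonneg X_nonneg[OF _ \<omega>]) simp
      ultimately show ?thesis by simp
    qed
  qed
  finally show "measure M ?E \<le> 2 * exp (- q * real (card {i. i < length D \<and> D ! i \<le> b}))"
    using upper by (simp add: mult.commute flip: exp_of_nat_mult)
qed

section \<open>Almost sure unboundedness of the process\<close>

theorem theorem1p3: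
  fixes T :: "'a set" and \<alpha> :: real and p :: nat
    and u :: "'a \<Rightarrow> 'a \<Rightarrow> real"
    and M :: "'s measure" and X :: "'a \<Rightarrow> 's \<Rightarrow> real"
    and \<Omega> :: "'w set" and F :: "ennreal \<Rightarrow> 'w measure" and A :: "'w measure"
    and P :: "'a option \<Rightarrow> 'w measure" and Y :: "ennreal \<Rightarrow> 'w \<Rightarrow> 'a option"
    and \<theta> :: "ennreal \<Rightarrow> 'w \<Rightarrow> 'w"
    and m :: "'a measure" and L :: "'a \<Rightarrow> ennreal \<Rightarrow> 'w \<Rightarrow> ennreal"
  assumes "countable T"
    and "\<alpha> > 0"
    and "transient_markov_process_with_local_times \<Omega> F A T P Y \<theta> m L u"
    and "permanental_process M T \<alpha> u X"
    and "p \<ge> 1"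
    and "limsup (\<lambda>n. ereal (ln (real n)) / psi_star T u n (n div p)) = \<infinity>"
  shows "AE \<omega> in M. (SUP t\<in>T. ereal (X t \<omega>)) = \<infinity>"
proof -
  interpret transient_markov_process_with_local_times \<Omega> F A T P Y \<theta> m L u by fact
  interpret prob_space M using assms(4) by (simp add: permanental_process_def)
  note max_le = permanental_max_le[OF assms(2,4)]
  define \<kappa> where "\<kappa> = exp (- 2) / (4 * Gamma \<alpha>)"
  have \<kappa>: "0 < \<kappa>" using Gamma_real_pos[OF assms(2)] by (simp add: \<kappa>_def)
  let ?E = "\<lambda>x. {\<omega>\<in>space M. \<forall>t\<in>T. X t \<omega> \<le> x}"
  have le_sets: "{\<omega>\<in>space M. X t \<omega> \<le> x} \<in> sets M" if "t \<in> T" for t x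
  proof -
    have "X t \<in> borel_measurable M" using assms(4) that by (auto simp: permanental_process_def)
    then show ?thesis by measurable
  qed
  have E_sets: "?E x \<in> sets M" for x
    using assms(1) by (intro sets.sets_Collect_countable_All' le_sets)
  have frequently_le: "\<exists>n\<ge>n0. measure M (?E x) \<le> 2 * exp (- (\<kappa> * (real n / real p - 1) / sqrt (real n)))"
    if x: "0 < x" for x :: real and n0 :: nat
  proof -
    \<comment> \<open>\<open>n \<ge> p\<close> gives \<open>n div p \<ge> 1\<close>, so that the
      index into the sorted diagonal is meaningful; \<open>n \<ge> 2\<close> gives
      \<open>ln n > 0\<close>.\<close>
    define n1 where "n1 = max n0 (max p 2)"
    \<comment> \<open>The 8 is twice the 4 in the exponent of \<open>permanental_max_le\<close>:
      \<open>b < ln n / (8 * x)\<close> gives \<open>exp (- (4 * x * b)) \<ge> 1 / sqrt n\<close>,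
      which loses against the number \<open>n div p\<close> of small rates.\<close>
    have "\<exists>n\<ge>n1. ereal (8 * x) < ereal (ln (real n)) / psi_star T u n (n div p)"
    proof (rule ccontr)
      assume "\<not> ?thesis"
      then have "\<forall>\<^sub>F n in sequentially. ereal (ln (real n)) / psi_star T u n (n div p) \<le> ereal (8 * x)"
        unfolding eventually_sequentially by (auto simp: not_less)
      from Limsup_bounded[OF this] show False using assms(6) by simp
    qed
    then obtain n where n: "n \<ge> n1" and gt: "ereal (8 * x) < ereal (ln (real n)) / psi_star T u n (n div p)"
      by auto
    have np: "n0 \<le> n" "p \<le> n" "2 \<le> n" using n by (auto simp: n1_def)
    have k: "1 \<le> n div p" "n div p \<le> n"
      using np assms(5) by (auto simp: Suc_le_eq div_greater_zero_iff)
    have ts_facts: "0 \<le> a_star u ts (n div p)" if "length ts = n" "distinct ts" "set ts \<subseteq> T" for ts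
    proof -
      let ?D = "diag_mat (the (mat_inverse (kernel_mat u ts)))"
      have "ts \<noteq> []" using that np by auto
      note D = max_le(2,3)[OF that(2,3) this x]
      have "n div p - 1 < n" using k np by linarith
      then have "sort ?D ! (n div p - 1) \<in> set (sort ?D)"
        using that(1) D(1) by (intro nth_mem) (simp only: length_sort)
      then show ?thesis using D(2) by (auto simp: a_star_def intro: less_imp_le)
    qed
    have "0 \<le> psi_star T u n (n div p)"
      unfolding psi_star_def by (rule INF_greatest) (use ts_facts in auto)
    moreover have "0 < ln (real n)" using np by simp
    ultimately have "psi_star T u n (n div p) < ereal (ln (real n) / (8 * x))"
    proof (cases "psi_star T u n (n div p)")
      case (real y)
      assume ln: "0 < ln (real n)" and "0 \<le> psi_star T u n (n div p)"
      then have "0 \<le> y" using real by simp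
      show ?thesis
      \<comment> \<open>The infimum may be 0; the quotient is then infinite, but the claimed bound
        on the infimum is immediate.\<close>
      proof (cases "y = 0")
        case True then show ?thesis using ln x real by simp
      next
        case False
        then have "0 < y" "8 * x < ln (real n) / y" using \<open>0 \<le> y\<close> gt real by simp_all
        then show ?thesis using x real by (simp add: pos_less_divide_eq mult.commute)
      qed
    \<comment> \<open>The value \<open>\<infinity>\<close>, taken when \<open>T\<close> has no
      \<open>n\<close> distinct elements, makes the quotient 0, against \<open>gt\<close>.\<close>
    qed (use gt x in simp_all)
    then obtain ts where ts: "length ts = n" "distinct ts" "set ts \<subseteq> T"
        and b: "a_star u ts (n div p) < ln (real n) / (8 * x)"
      unfolding psi_star_def Inf_less_iff by auto
    have "ts \<noteq> []" using ts np by auto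
    define b where "b = a_star u ts (n div p)"
    define D where "D = diag_mat (the (mat_inverse (kernel_mat u ts)))"
    let ?q = "\<kappa> * exp (- (4 * x * b))"
    have "measure M (?E x) \<le> measure M {\<omega>\<in>space M. \<forall>t\<in>set ts. X t \<omega> \<le> x}"
      using ts(3) by (intro finite_measure_mono sets.sets_Collect_finite_All le_sets) auto
    also have "\<dots> \<le> 2 * exp (- ?q * real (card {i. i < length D \<and> D ! i \<le> b}))"
      unfolding \<kappa>_def D_def by (rule max_le(1)[OF ts(2,3) \<open>ts \<noteq> []\<close> x])
    also have "\<dots> \<le> 2 * exp (- (\<kappa> * (real n / real p - 1) / sqrt (real n)))"
    proof -
      have "n div p \<le> card {i. i < length D \<and> D ! i \<le> b}"
        using k max_le(2)[OF ts(2,3) \<open>ts \<noteq> []\<close> x] ts(1)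
        by (intro le_card_if_sorted_nth_le) (auto simp: b_def D_def a_star_def)
      moreover have "real n / real p - 1 \<le> real (n div p)"
      proof -
        have "n < p + p * (n div p)" using assms(5) by (intro dividend_less_times_div) simp
        then have "real n < real p * (1 + real (n div p))"
          by (simp add: distrib_left flip: of_nat_mult of_nat_add)
        then show ?thesis using assms(5) by (simp add: field_simps)
      qed
      ultimately have card: "real n / real p - 1 \<le> real (card {i. i < length D \<and> D ! i \<le> b})"
        by linarith
      have "4 * x * b \<le> ln (real n) / 2" using b x unfolding b_def by (simp add: pos_less_divide_eq mult_ac)
      then have "exp (- (ln (real n) / 2)) \<le> exp (- (4 * x * b))" by simp
      moreover have "exp (- (ln (real n) / 2)) = 1 / sqrt (real n)"
      proof -
        have "exp (- (ln (real n) / 2)) = exp (- ln (sqrt (real n)))" using np by (simp add: ln_sqrt)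
        then show ?thesis using np by (simp only: exp_minus exp_ln real_sqrt_gt_zero inverse_eq_divide of_nat_0_less_iff)
      qed
      ultimately have le_q: "\<kappa> * (1 / sqrt (real n)) \<le> ?q" using \<kappa> by (intro mult_left_mono) auto
      have "0 \<le> real n / real p - 1" using np assms(5) by simp
      then have "\<kappa> * (1 / sqrt (real n)) * (real n / real p - 1)
          \<le> ?q * real (card {i. i < length D \<and> D ! i \<le> b})"
        using \<kappa> by (intro mult_mono le_q card) simp_all
      then have "- ?q * real (card {i. i < length D \<and> D ! i \<le> b})
          \<le> - (\<kappa> * (real n / real p - 1) / sqrt (real n))"
        by (simp only: mult_minus_left neg_le_iff_le times_divide_eq_left times_divide_eq_right mult_1_right)
      then show ?thesis by (simp only: exp_le_cancel_iff mult_le_cancel_left_pos zero_less_numeral)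
    qed
    finally show ?thesis using np(1) by (intro exI[of _ n] conjI)
  qed
  have null: "measure M (?E x) = 0" if "0 < x" for x
  proof (rule ccontr)
    assume "measure M (?E x) \<noteq> 0"
    then have pos: "0 < measure M (?E x)" by (simp add: less_le)
    have "0 < real p" using assms(5) by simp
    then have "(\<lambda>n. 2 * exp (- (\<kappa> * (real n / real p - 1) / sqrt (real n)))) \<longlonglongrightarrow> 0"
      using \<kappa> by real_asymp
    from order_tendstoD(2)[OF this pos] obtain n0 where
      "\<And>n. n \<ge> n0 \<Longrightarrow> 2 * exp (- (\<kappa> * (real n / real p - 1) / sqrt (real n))) < measure M (?E x)"
      unfolding eventually_sequentially by blast
    with frequently_le[OF that, of n0] show False by (meson not_less)
  qed
  \<comment> \<open>The levels \<open>Suc N\<close> are positive, as \<open>null\<close> requires,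
    and unbounded.\<close>
  have "AE \<omega> in M. \<forall>N::nat. \<not> (\<forall>t\<in>T. X t \<omega> \<le> real (Suc N))"
    unfolding AE_all_countable
  proof
    fix N :: nat
    have "?E (real (Suc N)) \<in> null_sets M"
      using E_sets null[of "real (Suc N)"] by (simp add: null_sets_def emeasure_eq_measure)
    from AE_not_in[OF this] show "AE \<omega> in M. \<not> (\<forall>t\<in>T. X t \<omega> \<le> real (Suc N))"
      by (rule AE_mp) simp
  qed
  then show ?thesis
  proof eventually_elim
    case (elim \<omega>)
    show ?case
    proof (rule ereal_top)
      fix B :: real
      obtain N where "B \<le> real N" using real_arch_simple by blast
      moreover obtain t where t: "t \<in> T" "real (Suc N) < X t \<omega>" using elim by (auto simp: not_le)
      ultimately have "ereal B \<le> ereal (X t \<omega>)" by simp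
      also have "\<dots> \<le> (SUP t\<in>T. ereal (X t \<omega>))" using t(1) by (rule SUP_upper)
      finally show "ereal B \<le> (SUP t\<in>T. ereal (X t \<omega>))" .
    qed
  qed
qed

end
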